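(* Let $m_1>m_2\ge 2$ be integers and let $r=m_1\bmod m_2\in\{0,\dots,m_2-1\}$ be the remainder in integer division of $m_1$ by $m_2$. If $r\ge 1$ and $$\left\lfloor\frac{m_1}{m_2}\right\rfloor>1+\frac{r^2}{m_2(m_2-r)},$$ then $$N_b(m_1,m_2)=N_e(m_1,m_2)=N_u(m_1,m_2)=\left\lfloor\frac{m_1}{m_2}\right\rfloor+1.$$ This formula holds, in particular, when $m_1\ge m_2^2$ and $r\ge 1$.
   Context: Let $\mathit{PD}(m)$ be the cone of real symmetric positive definite $m\times m$ matrices. For $\Sigma_1\in\mathit{PD}(m_1)$, $\Sigma_2\in\mathit{PD}(m_2)$, a random matrix $Y\in\mathbb{R}^{m_1\times m_2}$ has the (regular, mean-zero) matrix normal distribution $\mathcal N(0,\Sigma_2\otimes\Sigma_1)$ if $Y\stackrel{d}{=}AZB^T$ where $Z$ is $m_1\times m_2$ with i.i.d. standard normal entries, $\Sigma_1=AA^T$, $\Sigma_2=BB^T$; equivalently, the vectorization of $Y$ is centered Gaussian with covariance $\Sigma_2\otimes\Sigma_1$. Let $Y_1,\dots,Y_n$ be i.i.d. from such a distribution. Up to an additive constant, twice the log-likelihood as a function of the precision matrices $\Psi_j=\Sigma_j^{-1}$ is $$\ell(\Psi_1,\Psi_2)=nm_2\log\det(\Psi_1)+nm_1\log\det(\Psi_2)-\operatorname{tr}\Big(\Psi_1\sum_{i=1}^nY_i\Psi_2Y_i^T\Big),\quad (\Psi_1,\Psi_2)\in\mathit{PD}(m_1)\times\mathit{PD}(m_2).$$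 The Kronecker MLE exists if $\ell$ achieves its maximum over $\mathit{PD}(m_1)\times\mathit{PD}(m_2)$. It exists uniquely if in addition all local maxima of $\ell$ have the same Kronecker product $\Psi_2\otimes\Psi_1$. The existence threshold $N_e(m_1,m_2)$, uniqueness threshold $N_u(m_1,m_2)$ and boundedness threshold $N_b(m_1,m_2)$ are the positive integers such that: the Kronecker MLE exists almost surely if and only if $n\ge N_e(m_1,m_2)$; the Kronecker MLE exists uniquely almost surely if and only if $n\ge N_u(m_1,m_2)$; $\ell$ is bounded above almost surely if and only if $n\ge N_b(m_1,m_2)$. *)

theory Defs
  imports "HOL-Probability.Probability"
begin

definition PD :: "(real^'n^'n) set" where
  "PD = {S. transpose S = S \<and> (\<forall>x. x \<noteq> 0 \<longrightarrow> x \<bullet> (S *v x) > 0)}"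

definition kronecker :: "real^'b^'b \<Rightarrow> real^'a^'a \<Rightarrow> real^('b \<times> 'a)^('b \<times> 'a)" where
  "kronecker P Q = (\<chi> i j. P $ fst i $ fst j * Q $ snd i $ snd j)"

text \<open>An \<open>m\<^sub>1 \<times> m\<^sub>2\<close> matrix has type \<^typ>\<open>real^'b^'a\<close> with \<open>m\<^sub>1 = CARD('a)\<close> rows and
  \<open>m\<^sub>2 = CARD('b)\<close> columns.\<close>

definition std_normal_matrix :: "(real^'b::finite^'a::finite) measure" where
  "std_normal_matrix =
     distr (\<Pi>\<^sub>M p\<in>(UNIV :: ('a \<times> 'b) set). density lborel (\<lambda>x. ennreal (std_normal_density x)))
       borel (\<lambda>z. \<chi> i j. z (i, j))"

definition matrix_normal ::
  "real^'a::finite^'a \<Rightarrow> real^'b::finite^'b \<Rightarrow> (real^'b^'a) measure \<Rightarrow> bool" where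
  "matrix_normal S1 S2 \<mu> \<longleftrightarrow>
     (\<exists>(A :: real^'a^'a) (B :: real^'b^'b). S1 = A ** transpose A \<and> S2 = B ** transpose B \<and>
        \<mu> = distr std_normal_matrix borel (\<lambda>Z. A ** Z ** transpose B))"

text \<open>A sample of size \<open>n\<close> is \<open>Y 0, \<dots>, Y (n - 1)\<close>.\<close>

definition loglik ::
  "nat \<Rightarrow> (nat \<Rightarrow> real^'b::finite^'a::finite) \<Rightarrow> (real^'a^'a) \<times> (real^'b^'b) \<Rightarrow> real" where
  "loglik n Y = (\<lambda>(\<Psi>1, \<Psi>2).
     real n * real CARD('b) * ln (det \<Psi>1) + real n * real CARD('a) * ln (det \<Psi>2)
     - trace (\<Psi>1 ** (\<Sum>i<n. Y i ** \<Psi>2 ** transpose (Y i))))"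

definition loglik_bounded :: "nat \<Rightarrow> (nat \<Rightarrow> real^'b::finite^'a::finite) \<Rightarrow> bool" where
  "loglik_bounded n Y \<longleftrightarrow> bdd_above (loglik n Y ` (PD \<times> PD))"

definition mle_exists :: "nat \<Rightarrow> (nat \<Rightarrow> real^'b::finite^'a::finite) \<Rightarrow> bool" where
  "mle_exists n Y \<longleftrightarrow>
     (\<exists>\<Psi> \<in> PD \<times> PD. \<forall>\<Phi> \<in> PD \<times> PD. loglik n Y \<Phi> \<le> loglik n Y \<Psi>)"

definition local_max_on :: "('c::topological_space \<Rightarrow> real) \<Rightarrow> 'c set \<Rightarrow> 'c \<Rightarrow> bool" where
  "local_max_on f S x \<longleftrightarrow> x \<in> S \<and> (\<forall>\<^sub>F y in at x within S. f y \<le> f x)"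

definition mle_exists_uniquely :: "nat \<Rightarrow> (nat \<Rightarrow> real^'b::finite^'a::finite) \<Rightarrow> bool" where
  "mle_exists_uniquely n Y \<longleftrightarrow> mle_exists n Y \<and>
     (\<forall>\<Psi>1 \<Psi>2 \<Phi>1 \<Phi>2.
        local_max_on (loglik n Y) (PD \<times> PD) (\<Psi>1, \<Psi>2) \<longrightarrow>
        local_max_on (loglik n Y) (PD \<times> PD) (\<Phi>1, \<Phi>2) \<longrightarrow>
        kronecker \<Psi>2 \<Psi>1 = kronecker \<Phi>2 \<Phi>1)"

text \<open>The positive integer \<open>N\<close> is the threshold for the property \<open>P\<close> of samples if \<open>P\<close> holds
  almost surely exactly for the sample sizes \<open>n \<ge> N\<close>. One and the same \<open>N\<close> has to serve for all
  regular matrix normal distributions. Sample sizes are positive.\<close>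

definition is_threshold ::
  "(nat \<Rightarrow> (nat \<Rightarrow> real^'b::finite^'a::finite) \<Rightarrow> bool) \<Rightarrow> nat \<Rightarrow> bool" where
  "is_threshold P N \<longleftrightarrow> N \<ge> 1 \<and>
     (\<forall>S1 \<in> PD. \<forall>S2 \<in> PD. \<forall>\<mu>. matrix_normal S1 S2 \<mu> \<longrightarrow>
       (\<forall>n\<ge>1. (AE Y in (\<Pi>\<^sub>M i\<in>{..<n}. \<mu>). P n Y) \<longleftrightarrow> n \<ge> N))"

lemma mat_1_in_PD: "mat 1 \<in> PD"
  by (auto simp: PD_def transpose_mat)

lemma is_threshold_unique:
  fixes P :: "nat \<Rightarrow> (nat \<Rightarrow> real^'b::finite^'a::finite) \<Rightarrow> bool"
  assumes "is_threshold P M" "is_threshold P N"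
  shows "M = N"
proof -
  obtain \<mu> :: "(real^'b^'a) measure" where \<mu>: "matrix_normal (mat 1) (mat 1) \<mu>"
    unfolding matrix_normal_def by (metis matrix_mul_lid transpose_mat)
  have pd: "(mat 1 :: real^'a^'a) \<in> PD" "(mat 1 :: real^'b^'b) \<in> PD"
    by (rule mat_1_in_PD)+
  have "n \<ge> M \<longleftrightarrow> n \<ge> N" if "n \<ge> 1" for n
  proof -
    have "(AE Y in (\<Pi>\<^sub>M i\<in>{..<n}. \<mu>). P n Y) \<longleftrightarrow> n \<ge> M"
      using assms(1) \<mu> pd that unfolding is_threshold_def by blast
    moreover have "(AE Y in (\<Pi>\<^sub>M i\<in>{..<n}. \<mu>). P n Y) \<longleftrightarrow> n \<ge> N"
      using assms(2) \<mu> pd that unfolding is_threshold_def by blast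
    ultimately show ?thesis by simp
  qed
  moreover have "M \<ge> 1" "N \<ge> 1"
    using assms by (auto simp: is_threshold_def)
  ultimately show ?thesis
    by (meson le_antisym order_refl)
qed

definition is_boundedness_threshold :: "'a::finite itself \<Rightarrow> 'b::finite itself \<Rightarrow> nat \<Rightarrow> bool" where
  "is_boundedness_threshold _ _ =
     is_threshold (loglik_bounded :: nat \<Rightarrow> (nat \<Rightarrow> real^'b^'a) \<Rightarrow> bool)"

definition is_existence_threshold :: "'a::finite itself \<Rightarrow> 'b::finite itself \<Rightarrow> nat \<Rightarrow> bool" where
  "is_existence_threshold _ _ =
     is_threshold (mle_exists :: nat \<Rightarrow> (nat \<Rightarrow> real^'b^'a) \<Rightarrow> bool)"

definition is_uniqueness_threshold :: "'a::finite itself \<Rightarrow> 'b::finite itself \<Rightarrow> nat \<Rightarrow> bool" where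
  "is_uniqueness_threshold _ _ =
     is_threshold (mle_exists_uniquely :: nat \<Rightarrow> (nat \<Rightarrow> real^'b^'a) \<Rightarrow> bool)"

end

theory Submission
  imports Defs
begin

text \<open>
  Write \<open>m\<^sub>1 = k m\<^sub>2 + r\<close> and \<open>N = k + 1\<close>. For \<open>n \<le> k\<close> the sample has \<open>n m\<^sub>2 < m\<^sub>1\<close> columns, so some
  \<open>v \<noteq> 0\<close> is orthogonal to all of them; stretching \<open>\<Psi>\<^sub>1\<close> along \<open>v\<close> raises its determinant without
  changing the trace term, and the log-likelihood is unbounded for every sample
  (\<open>loglik_unbounded_small_sample\<close>).

  For \<open>n \<ge> N\<close> the argument splits into a deterministic and a probabilistic half, which meet in the
  notion of a \<^emph>\<open>stable\<close> sample: nonzero subspaces \<open>V\<close> of the column index space and \<open>W\<close> of the row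
  index space (of dimensions \<open>m\<^sub>2\<close> and \<open>m\<^sub>1\<close>) for which \<open>w \<bullet> Y\<^sub>i v = 0\<close> throughout must satisfy
  \<open>dim V / m\<^sub>2 + dim W / m\<^sub>1 < 1\<close>.

  Deterministic half: any two points of \<open>PD \<times> PD\<close> are joined by a curve
  \<open>\<lambda> \<mapsto> (C diag(e\<^bsup>\<lambda>s\<^esup>) C\<^sup>T, D diag(e\<^bsup>\<lambda>t\<^esup>) D\<^sup>T)\<close>. On it the negative log-likelihood is, up to a
  constant, \<open>\<Sum> e\<^bsup>\<lambda>(s\<^sub>a + t\<^sub>b)\<^esup> w\<^sub>a\<^sub>b - \<lambda> \<kappa>\<close> with weights \<open>w\<^sub>a\<^sub>b \<ge> 0\<close> and \<open>\<kappa>\<close> linear in \<open>s, t\<close>, hence convex.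
  Stability of the sample is a Hall condition on the support of \<open>w\<close>, and
  \<open>weighted_hall_inequality\<close> turns it into growth along every such ray other than the rescalings
  \<open>(e\<^bsup>-c\<^esup> \<Psi>\<^sub>1, e\<^sup>c \<Psi>\<^sub>2)\<close>, which leave the likelihood and the Kronecker product alone. Compactness of the
  orthogonal group makes the growth uniform, so a maximum exists; and the convex function along the
  curve between two local maxima is constant, which only a rescaling allows.

  Probabilistic half: for subspaces \<open>V, W\<close> of dimensions \<open>d, p\<close>, the conditions \<open>w \<bullet> Y\<^sub>i v = 0\<close> let one
  solve for \<open>N p d\<close> entries of the first \<open>N\<close> matrices in terms of the other entries and of the
  \<open>p (m\<^sub>1 - p) + d (m\<^sub>2 - d)\<close> coordinates of \<open>W\<close> and \<open>V\<close>. If these coordinates are fewer than the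
  entries solved for, such samples lie in a smooth image of a hyperplane, hence in a null set. For
  the dimensions that violate stability this holds as soon as \<open>m\<^sub>1\<^sup>2 + m\<^sub>2\<^sup>2 < N m\<^sub>1 m\<^sub>2\<close>
  (\<open>stability_dimension_count\<close>), and with \<open>N = k + 1\<close> that inequality is equivalent to
  \<open>k > 1 + r\<^sup>2 / (m\<^sub>2 (m\<^sub>2 - r))\<close>. Regular matrix normal distributions are absolutely continuous, so
  almost every sample is stable.
\<close>

section \<open>Positive definite matrices in spectral coordinates\<close>

text \<open>A maximum point of the quadratic form \<open>x \<bullet> M x\<close> on the unit sphere of the orthogonal complement of
  \<open>B\<close> is an eigenvector, because that complement is invariant under \<open>M\<close>.\<close>

lemma eigenvector_orthogonal_to_eigenvectors:
  fixes M :: "real^'n^'n"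
  assumes sym: "transpose M = M"
    and B: "finite B" "card B < CARD('n)" "\<And>b. b \<in> B \<Longrightarrow> \<exists>c. M *v b = c *\<^sub>R b"
  obtains x c where "norm x = 1" "\<And>b. b \<in> B \<Longrightarrow> x \<bullet> b = 0" "M *v x = c *\<^sub>R x"
proof -
  have adj: "x \<bullet> (M *v y) = (M *v x) \<bullet> y" for x y
    by (metis dot_lmul_matrix sym transpose_matrix_vector)
  define W where "W = {x. \<forall>b\<in>B. x \<bullet> b = 0}"
  have "subspace W"
    by (auto simp: W_def subspace_def inner_add_left)
  have inv: "M *v x \<in> W" if "x \<in> W" for x
  proof -
    have "(M *v x) \<bullet> b = 0" if b: "b \<in> B" for b
    proof -
      obtain c where "M *v b = c *\<^sub>R b" using B(3) b by blast
      then have "(M *v x) \<bullet> b = c * (x \<bullet> b)" by (simp flip: adj)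
      then show ?thesis using \<open>x \<in> W\<close> b by (simp add: W_def)
    qed
    then show ?thesis by (simp add: W_def)
  qed
  have "dim (span B) < DIM(real^'n)"
    using B(1,2) dim_le_card'[OF B(1)] by (simp add: dim_span)
  then obtain a where a: "a \<noteq> 0" "\<And>x. x \<in> span B \<Longrightarrow> orthogonal a x"
    by (metis orthogonal_to_subspace_exists dim_span span_span)
  have aW: "a \<in> W" using a(2) by (auto simp: W_def orthogonal_def span_base)
  define K where "K = sphere 0 1 \<inter> W"
  have "closed W"
    using \<open>subspace W\<close> closed_subspace by blast
  then have "compact K" unfolding K_def by (intro compact_Int_closed) auto
  moreover have "a /\<^sub>R norm a \<in> K"
    using a aW \<open>subspace W\<close> by (simp add: K_def subspace_scale)
  moreover have "continuous_on K (\<lambda>x. x \<bullet> (M *v x))"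
    by (intro continuous_intros matrix_vector_mult_linear_continuous_on)
  ultimately obtain x where x: "x \<in> K" "\<And>y. y \<in> K \<Longrightarrow> y \<bullet> (M *v y) \<le> x \<bullet> (M *v x)"
    using continuous_attains_sup[of K] by blast
  define c where "c = x \<bullet> (M *v x)"
  have nx: "x \<bullet> x = 1" and xW: "x \<in> W" using x(1) by (auto simp: K_def dot_square_norm)
  have quad: "z \<bullet> (M *v z) \<le> c * (z \<bullet> z)" if "z \<in> W" for z
  proof (cases "z = 0")
    case False
    define u where "u = z /\<^sub>R norm z"
    have "u \<in> K" using False that \<open>subspace W\<close> by (simp add: u_def K_def subspace_scale)
    then have "u \<bullet> (M *v u) \<le> c" using x(2) c_def by simp
    moreover have "z = norm z *\<^sub>R u" using False by (simp add: u_def)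
    then have "z \<bullet> (M *v z) = (norm z)^2 * (u \<bullet> (M *v u))"
      by (metis (no_types, lifting) inner_scaleR_left inner_scaleR_right matrix_vector_mult_scaleR mult.assoc power2_eq_square)
    ultimately show ?thesis
      by (simp add: power2_norm_eq_inner[symmetric] mult.commute mult_right_mono)
  qed simp
  define y where "y = M *v x - c *\<^sub>R x"
  have yW: "y \<in> W" unfolding y_def
    using \<open>subspace W\<close> inv xW by (intro subspace_diff subspace_scale) auto
  have yx: "y \<bullet> x = 0" by (simp add: y_def inner_diff_left nx) (simp add: c_def inner_commute)
  have yMx: "y \<bullet> (M *v x) = y \<bullet> y"
  proof -
    have "M *v x = y + c *\<^sub>R x" by (simp add: y_def)
    then show ?thesis by (simp add: inner_add_right yx)
  qed
  \<comment> \<open>First-order optimality: compare \<open>x\<close> with \<open>x + e y\<close>, where \<open>y\<close> is the residual of the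
    eigenvalue equation; this will be used for small \<open>e\<close>.\<close>
  have ineq: "2 * (y \<bullet> y) \<le> e * (c * (y \<bullet> y) - y \<bullet> (M *v y))" if "e > 0" for e
  proof -
    have "x + e *\<^sub>R y \<in> W"
      using \<open>subspace W\<close> xW yW by (intro subspace_add subspace_scale)
    from quad[OF this] have "c + 2 * e * (y \<bullet> y) + e * e * (y \<bullet> (M *v y)) \<le> c * (1 + e * e * (y \<bullet> y))"
      by (simp add: algebra_simps inner_add_left inner_add_right matrix_vector_right_distrib
          matrix_vector_mult_scaleR yMx yx nx inner_commute[of x y] c_def[symmetric]
          adj[of x y] inner_commute[of "M *v x" y])
    then have "e * (2 * (y \<bullet> y)) \<le> e * (e * (c * (y \<bullet> y) - y \<bullet> (M *v y)))"
      by (simp add: algebra_simps)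
    then show ?thesis using that by simp
  qed
  have "y \<bullet> y \<le> 0"
  proof (rule ccontr)
    assume pos: "\<not> y \<bullet> y \<le> 0"
    define d where "d = c * (y \<bullet> y) - y \<bullet> (M *v y)"
    have "2 * (y \<bullet> y) \<le> d" using ineq[of 1] by (simp add: d_def)
    then have d: "d > 0" using pos by linarith
    have "2 * (y \<bullet> y) \<le> (y \<bullet> y) / d * d"
      using ineq[of "(y \<bullet> y) / d"] d pos unfolding d_def[symmetric] by (meson divide_pos_pos not_le)
    then show False using d pos by simp
  qed
  then have "y = 0" by (metis inner_ge_zero inner_eq_zero_iff order_antisym)
  then have "M *v x = c *\<^sub>R x" by (simp add: y_def)
  moreover have "norm x = 1" using nx by (simp add: norm_eq_1)
  ultimately show thesis using that xW W_def by auto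
qed

lemma orthonormal_eigenvectors:
  fixes M :: "real^'n^'n"
  assumes "transpose M = M" "k \<le> CARD('n)"
  shows "\<exists>B. finite B \<and> card B = k \<and> pairwise orthogonal B \<and>
             (\<forall>b\<in>B. norm b = 1 \<and> (\<exists>c. M *v b = c *\<^sub>R b))"
  using assms(2)
proof (induction k)
  case 0
  then show ?case by (intro exI[of _ "{}"]) auto
next
  case (Suc k)
  then obtain B where B: "finite B" "card B = k" "pairwise orthogonal B"
    "\<And>b. b \<in> B \<Longrightarrow> norm b = 1" "\<And>b. b \<in> B \<Longrightarrow> \<exists>c. M *v b = c *\<^sub>R b"
    by (metis Suc_leD)
  then obtain x c where x: "norm x = 1" "\<And>b. b \<in> B \<Longrightarrow> x \<bullet> b = 0" "M *v x = c *\<^sub>R x"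
    using eigenvector_orthogonal_to_eigenvectors[OF assms(1), of B] Suc.prems
    by (metis Suc_le_lessD)
  have "x \<notin> B" using x(1,2) by (metis norm_eq_1 zero_neq_one)
  then show ?case using B x
    by (intro exI[of _ "insert x B"])
       (auto simp: pairwise_insert orthogonal_def[of x] orthogonal_def[of _ x] inner_commute[of _ x])
qed

text \<open>The matrix \<open>C diag(e\<^sup>t) C\<^sup>T\<close>. For orthogonal \<open>C\<close> these are spectral decompositions; for fixed \<open>C\<close> the lines
  through \<open>0\<close> in \<open>t\<close> are geodesics of the cone of positive definite matrices starting at \<open>C C\<^sup>T\<close>.\<close>

definition diag_exp :: "real^'n^'n \<Rightarrow> real^'n \<Rightarrow> real^'n^'n" where
  "diag_exp C t = (\<chi> i j. \<Sum>k\<in>UNIV. C $ i $ k * exp (t $ k) * C $ j $ k)"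

lemma diag_exp_eq_matrix_product:
  "diag_exp C t = C ** (\<chi> i j. if i = j then exp (t $ i) else 0) ** transpose C"
  by (simp add: diag_exp_def matrix_matrix_mult_def transpose_def vec_eq_iff if_distrib sum.delta' cong: if_cong)

lemma det_diag_exp: "det (diag_exp C t) = (det C)\<^sup>2 * exp (\<Sum>k\<in>UNIV. t $ k)"
  by (simp add: diag_exp_eq_matrix_product det_mul det_diagonal exp_sum power2_eq_square)

lemma transpose_diag_exp: "transpose (diag_exp C t) = diag_exp C t"
  by (simp add: diag_exp_def transpose_def vec_eq_iff mult.commute mult.left_commute)

lemma inner_diag_exp: "x \<bullet> (diag_exp C t *v x) = (\<Sum>k\<in>UNIV. exp (t $ k) * ((transpose C *v x) $ k)\<^sup>2)"
proof -
  let ?E = "\<chi> i j. if i = j then exp (t $ i) else 0"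
  have "x \<bullet> (diag_exp C t *v x) = (transpose C *v x) \<bullet> (?E *v (transpose C *v x))"
    by (simp add: diag_exp_eq_matrix_product transpose_matrix_vector dot_lmul_matrix flip: matrix_vector_mul_assoc)
  also have "\<dots> = (\<Sum>k\<in>UNIV. exp (t $ k) * ((transpose C *v x) $ k)\<^sup>2)"
  proof -
    have "(?E *v y) $ k = exp (t $ k) * y $ k" for y k
      by (simp add: matrix_vector_mult_def if_distrib[of "\<lambda>z. z * _"] cong: if_cong)
    then show ?thesis by (simp add: inner_vec_def power2_eq_square mult_ac)
  qed
  finally show ?thesis .
qed

lemma diag_exp_in_PD:
  assumes "invertible C"
  shows "diag_exp C t \<in> PD"
proof -
  have "x \<bullet> (diag_exp C t *v x) > 0" if "x \<noteq> 0" for x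
  proof -
    have "transpose C *v x \<noteq> 0"
      using assms that transpose_invertible matrix_left_invertible_ker
      by (metis invertible_def)
    then obtain k where "(transpose C *v x) $ k \<noteq> 0" by (auto simp: vec_eq_iff)
    then show ?thesis unfolding inner_diag_exp
      by (intro sum_pos2[of _ k]) auto
  qed
  then show ?thesis by (auto simp: PD_def transpose_diag_exp)
qed

lemma PD_spectral_decomposition:
  fixes M :: "real^'n^'n"
  assumes "M \<in> PD"
  obtains C t where "orthogonal_matrix C" "M = diag_exp C t"
proof -
  from assms have sym: "transpose M = M" and pos: "\<And>x. x \<noteq> 0 \<Longrightarrow> x \<bullet> (M *v x) > 0"
    by (auto simp: PD_def)
  obtain B where B: "finite B" "card B = CARD('n)" "pairwise orthogonal B"
    "\<And>b. b \<in> B \<Longrightarrow> norm b = 1" "\<And>b. b \<in> B \<Longrightarrow> \<exists>c. M *v b = c *\<^sub>R b"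
    using orthonormal_eigenvectors[OF sym order_refl] by blast
  obtain h where h: "bij_betw h (UNIV::'n set) B"
    using B(1,2) by (metis finite_class.finite_UNIV finite_same_card_bij)
  then have hB: "h k \<in> B" for k by (auto simp: bij_betw_def)
  define C where "C = (\<chi> i k. h k $ i)"
  have col: "column k C = h k" for k by (simp add: column_def C_def vec_eq_iff)
  have "orthogonal (h i) (h j)" if "i \<noteq> j" for i j
    using B(3) hB that h unfolding pairwise_def bij_betw_def by (metis inj_eq)
  then have orth: "orthogonal_matrix C"
    unfolding orthogonal_matrix_orthonormal_columns using B(4) hB by (simp add: col)
  have "\<forall>k. \<exists>c. M *v h k = c *\<^sub>R h k" using B(5) hB by blast
  from choice[OF this] obtain c where c: "\<And>k. M *v h k = c k *\<^sub>R h k" by blast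
  have cpos: "c k > 0" for k
  proof -
    have "h k \<noteq> 0" using B(4)[OF hB[of k]] by auto
    from pos[OF this] have "c k * (h k \<bullet> h k) > 0" by (simp add: c)
    then show ?thesis using B(4)[OF hB[of k]] by (simp add: norm_eq_1)
  qed
  let ?D = "(\<chi> i j. if i = j then c i else 0) :: real^'n^'n"
  have MC: "M ** C = C ** ?D"
  proof -
    have "(M ** C) $ i $ k = (C ** ?D) $ i $ k" for i k
    proof -
      have "(M ** C) $ i $ k = (M *v h k) $ i"
        by (simp add: matrix_matrix_mult_def matrix_vector_mult_def C_def)
      also have "\<dots> = (C ** ?D) $ i $ k"
        by (simp add: c) (simp add: matrix_matrix_mult_def C_def if_distrib cong: if_cong)
      finally show ?thesis .
    qed
    then show ?thesis by (simp add: vec_eq_iff)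
  qed
  have "M = M ** (C ** transpose C)"
    using orth by (simp only: orthogonal_matrix_def matrix_mul_rid)
  also have "\<dots> = C ** ?D ** transpose C"
    by (simp only: matrix_mul_assoc MC)
  also have "\<dots> = diag_exp C (\<chi> k. ln (c k))"
    by (simp add: diag_exp_eq_matrix_product cpos cong: if_cong)
  finally show thesis by (rule that[OF orth])
qed

lemma orthogonal_matrix_invertible:
  "orthogonal_matrix (C::real^'n^'n) \<Longrightarrow> invertible C"
  unfolding orthogonal_matrix_def invertible_def by blast

text \<open>Write \<open>M = A A\<^sup>T\<close>, diagonalize \<open>A\<^sup>-\<^sup>1 N A\<^sup>-\<^sup>T = V diag(e\<^sup>t) V\<^sup>T\<close>, and take \<open>C = A V\<close>: the factor \<open>V\<close> cancels
  in \<open>C C\<^sup>T\<close>. This provides the geodesic from \<open>M\<close> to \<open>N\<close>.\<close>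

lemma PD_simultaneous_diagonalization:
  fixes M N :: "real^'n^'n"
  assumes "M \<in> PD" "N \<in> PD"
  obtains C t where "invertible C" "M = diag_exp C 0" "N = diag_exp C t"
proof -
  obtain U u where U: "orthogonal_matrix U" "M = diag_exp U u"
    by (rule PD_spectral_decomposition[OF assms(1)])
  define A where "A = U ** (\<chi> i j. if i = j then exp (u $ i / 2) else 0)"
  have "det (\<chi> i j. if i = j then exp (u $ i / 2) else 0) \<noteq> 0"
    by (subst det_diagonal) (auto)
  then have A: "invertible A"
    using orthogonal_matrix_invertible[OF U(1)] unfolding A_def invertible_det_nz det_mul by simp
  have Aik: "A $ i $ k = U $ i $ k * exp (u $ k / 2)" for i k
    by (simp add: A_def matrix_matrix_mult_def if_distrib cong: if_cong)
  have half: "exp (u $ k) = exp (u $ k / 2) * exp (u $ k / 2)" for k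
    by (simp flip: exp_add)
  have "U $ i $ k * exp (u $ k) * U $ j $ k = A $ i $ k * A $ j $ k" for i j k
    unfolding Aik half by (simp only: mult_ac)
  then have MA: "M = A ** transpose A"
    by (simp add: U(2) diag_exp_def matrix_matrix_mult_def transpose_def vec_eq_iff)
  obtain A' where A': "A ** A' = mat 1" "A' ** A = mat 1" using A by (auto simp: invertible_def)
  define N' where "N' = A' ** N ** transpose A'"
  have "N' \<in> PD"
  proof -
    have "transpose N' = N'"
      using assms(2) by (simp add: N'_def PD_def matrix_transpose_mul matrix_mul_assoc)
    moreover have "x \<bullet> (N' *v x) > 0" if "x \<noteq> 0" for x
    proof -
      have "transpose A' *v x \<noteq> 0"
      proof
        assume "transpose A' *v x = 0"
        then have "(transpose A ** transpose A') *v x = 0"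
          by (simp flip: matrix_vector_mul_assoc)
        moreover have "transpose A ** transpose A' = mat 1"
          by (simp add: A'(2) transpose_mat flip: matrix_transpose_mul)
        ultimately show False using that by simp
      qed
      then have "(transpose A' *v x) \<bullet> (N *v (transpose A' *v x)) > 0"
        using assms(2) by (auto simp: PD_def)
      also have "(transpose A' *v x) \<bullet> (N *v (transpose A' *v x)) = x \<bullet> (N' *v x)"
        by (simp add: N'_def transpose_matrix_vector dot_lmul_matrix flip: matrix_vector_mul_assoc)
      finally show ?thesis .
    qed
    ultimately show ?thesis by (auto simp: PD_def)
  qed
  then obtain V t where V: "orthogonal_matrix V" "N' = diag_exp V t"
    using PD_spectral_decomposition by blast
  define C where "C = A ** V"
  have "invertible C"
    using A orthogonal_matrix_invertible[OF V(1)] unfolding C_def by (simp add: invertible_mult)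
  moreover have "M = diag_exp C 0"
  proof -
    have "diag_exp C 0 = C ** mat 1 ** transpose C"
      by (simp add: diag_exp_eq_matrix_product mat_def cong: if_cong)
    also have "\<dots> = A ** (V ** transpose V) ** transpose A"
      by (simp add: C_def matrix_transpose_mul matrix_mul_assoc)
    also have "\<dots> = M" using V(1) by (simp add: orthogonal_matrix_def MA)
    finally show ?thesis by (rule sym)
  qed
  moreover have "N = diag_exp C t"
  proof -
    have "diag_exp C t = A ** diag_exp V t ** transpose A"
      by (simp add: diag_exp_eq_matrix_product C_def matrix_transpose_mul matrix_mul_assoc)
    also have "\<dots> = (A ** A') ** N ** transpose (A ** A')"
      by (simp add: V(2)[symmetric] N'_def matrix_transpose_mul matrix_mul_assoc)
    also have "\<dots> = N" by (simp add: A' transpose_mat)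
    finally show ?thesis by (rule sym)
  qed
  ultimately show thesis by (rule that)
qed

section \<open>A weighted Hall inequality\<close>

text \<open>The first assumption is the stability inequality for pairs of sets with no edge of \<open>R\<close> between them:
  every nonempty \<open>T\<close> has at least \<open>card T\<close> neighbours up to the factor \<open>m\<^sub>1 / m\<^sub>2\<close>, strictly more if \<open>T\<close>
  is proper. Under \<open>s\<^sub>a + t\<^sub>b \<le> 0\<close> on the edges, large values of \<open>t\<close> on \<open>T\<close> force small values
  of \<open>s\<close> on its neighbours, and the neighbours outweigh \<open>T\<close>. The induction is on the number of values of
  \<open>t\<close>: lowering the highest level of \<open>t\<close> to the second highest, and raising \<open>s\<close> on the neighbours of
  that level by the same amount, keeps the constraints and strictly increases \<open>\<kappa>\<close>.\<close>

lemma weighted_hall_inequality: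
  fixes s :: "'a::finite \<Rightarrow> real" and t :: "'b::finite \<Rightarrow> real"
  assumes stab: "\<And>P T. P \<noteq> {} \<Longrightarrow> T \<noteq> {} \<Longrightarrow> (\<And>a b. a \<in> P \<Longrightarrow> b \<in> T \<Longrightarrow> \<not> R a b)
            \<Longrightarrow> card T * CARD('a) + card P * CARD('b) < CARD('a) * CARD('b)"
    and neg: "\<And>a b. R a b \<Longrightarrow> s a + t b \<le> 0"
  defines "\<kappa> \<equiv> real CARD('b) * sum s UNIV + real CARD('a) * sum t UNIV"
  shows "\<kappa> < 0 \<or> (\<exists>c. (\<forall>a. s a = - c) \<and> (\<forall>b. t b = c))"
  using neg unfolding \<kappa>_def
proof (induction "card (range t)" arbitrary: s t rule: less_induct)
  case less
  note neg = less.prems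
  show ?case
  proof (cases "\<exists>c. \<forall>b. t b = c")
    case True
    then obtain c where c: "\<And>b. t b = c" by blast
    have le: "s a \<le> - c" for a
    proof -
      \<comment> \<open>An isolated \<open>a\<close> would violate the stability inequality with \<open>T\<close> the whole type.\<close>
      have "\<exists>b. R a b" using stab[of "{a}" UNIV] by auto
      then show ?thesis using neg c by fastforce
    qed
    show ?thesis
    proof (cases "\<forall>a. s a = - c")
      case False
      then obtain a where a: "s a < - c" using le by (metis order_le_less)
      have "sum s UNIV < sum (\<lambda>_::'a. - c) UNIV"
        by (intro sum_strict_mono_ex1) (use le a in auto)
      then have "sum s UNIV < - c * real CARD('a)" by (simp add: mult.commute)
      then have "real CARD('b) * sum s UNIV < real CARD('b) * (- c * real CARD('a))"
        by (intro mult_strict_left_mono) auto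
      then show ?thesis by (simp add: c algebra_simps)
    qed (use c in blast)
  next
    case False
    define M where "M = Max (range t)"
    define M' where "M' = Max (range t - {M})"
    have tM: "t b \<le> M" for b by (simp add: M_def)
    have "M \<in> range t" unfolding M_def by (intro Max_in) auto
    then obtain b0 where b0: "t b0 = M" by auto
    obtain b1 where b1: "t b1 \<noteq> M" using False by blast
    have "M' \<in> range t - {M}" unfolding M'_def by (intro Max_in) (use b1 in auto)
    then have M'r: "M' \<in> range t" "M' < M" using tM by (auto simp: order_less_le)
    have tM': "t b \<le> M'" if "t b \<noteq> M" for b
      unfolding M'_def using that by (intro Max_ge) auto
    define T where "T = {b. t b = M}"
    define N where "N = {a. \<exists>b\<in>T. R a b}"
    define d where "d = M - M'"
    define s' where "s' a = s a + (if a \<in> N then d else 0)" for a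
    define t' where "t' b = t b - (if b \<in> T then d else 0)" for b
    have "range t' \<subseteq> range t - {M}"
      using M'r by (auto simp: t'_def T_def d_def split: if_splits)
    then have card: "card (range t') < card (range t)"
      using \<open>M \<in> range t\<close> by (intro psubset_card_mono) auto
    have "s' a + t' b \<le> 0" if "R a b" for a b
    proof (cases "b \<in> T")
      case True
      then show ?thesis using that neg[OF that] by (auto simp: s'_def t'_def N_def)
    next
      case bT: False
      show ?thesis
      proof (cases "a \<in> N")
        case True
        then obtain b' where "R a b'" "t b' = M" by (auto simp: N_def T_def)
        then have "s a \<le> - M" using neg[of a b'] by simp
        then show ?thesis using bT tM'[of b] True by (simp add: s'_def t'_def d_def T_def)
      qed (use bT neg[OF that] in \<open>simp add: s'_def t'_def\<close>)
    qed
    then have "real CARD('b) * sum s' UNIV + real CARD('a) * sum t' UNIV < 0 \<or>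
        (\<exists>c. (\<forall>a. s' a = - c) \<and> (\<forall>b. t' b = c))"
      by (rule less.hyps[OF card])
    then have "real CARD('b) * sum s' UNIV + real CARD('a) * sum t' UNIV \<le> 0"
    proof (elim disjE exE)
      fix c assume "(\<forall>a. s' a = - c) \<and> (\<forall>b. t' b = c)"
      then have "s' = (\<lambda>_. - c)" "t' = (\<lambda>_. c)" by auto
      then show ?thesis by simp
    qed simp
    moreover have "sum s' UNIV = sum s UNIV + d * real (card N)"
      by (simp add: s'_def sum.distrib sum.If_cases)
    moreover have "sum t' UNIV = sum t UNIV - d * real (card T)"
      by (simp add: t'_def sum_subtractf sum.If_cases)
    moreover have "real (card T) * real CARD('a) < real (card N) * real CARD('b)"
    proof (cases "N = UNIV")
      case True
      have "T \<noteq> UNIV" using b1 by (auto simp: T_def)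
      then have "card T < CARD('b)" by (intro psubset_card_mono) auto
      then show ?thesis using True by simp
    next
      case False
      have "card T * CARD('a) + card (- N) * CARD('b) < CARD('a) * CARD('b)"
        by (rule stab) (use False b0 in \<open>auto simp: T_def N_def\<close>)
      moreover have "card (- N) + card N = CARD('a)"
        using card_Un_disjoint[of "- N" N] by (simp add: Compl_partition2)
      then have "CARD('a) * CARD('b) = card (- N) * CARD('b) + card N * CARD('b)"
        by (simp flip: distrib_right)
      ultimately show ?thesis by (simp flip: of_nat_mult)
    qed
    then have "d * (real (card T) * real CARD('a)) < d * (real (card N) * real CARD('b))"
      using M'r by (simp add: d_def)
    ultimately have "real CARD('b) * sum s UNIV + real CARD('a) * sum t UNIV < 0"
      by (simp add: algebra_simps)
    then show ?thesis by simp
  qed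
qed

section \<open>The log-likelihood in spectral coordinates\<close>

text \<open>The coefficient of \<open>e\<^bsup>s\<^sub>a + t\<^sub>b\<^esup>\<close> in the trace term of the log-likelihood at the point with coordinates \<open>s, t\<close>
  in the frames \<open>C, D\<close>.\<close>

definition weight :: "nat \<Rightarrow> (nat \<Rightarrow> real^'b^'a) \<Rightarrow> real^'a^'a \<Rightarrow> real^'b^'b \<Rightarrow> 'a \<Rightarrow> 'b \<Rightarrow> real" where
  "weight n Y C D a b = (\<Sum>i<n. ((transpose C ** Y i ** D) $ a $ b)\<^sup>2)"

lemma weight_nonneg: "weight n Y C D a b \<ge> 0"
  by (simp add: weight_def sum_nonneg)

lemma weight_eq_0_iff: "weight n Y C D a b = 0 \<longleftrightarrow> (\<forall>i<n. (transpose C ** Y i ** D) $ a $ b = 0)"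
  unfolding weight_def by (subst sum_nonneg_eq_0_iff) auto

lemma trace_diag_exp_product:
  fixes X :: "real^'b^'a"
  shows "trace (diag_exp C s ** (X ** diag_exp D t ** transpose X)) =
    (\<Sum>a\<in>UNIV. \<Sum>b\<in>UNIV. exp (s $ a + t $ b) * ((transpose C ** X ** D) $ a $ b)\<^sup>2)"
proof -
  define E where "E = ((\<chi> i j. if i = j then exp (s $ i) else 0) :: real^'a^'a)"
  define F where "F = ((\<chi> i j. if i = j then exp (t $ i) else 0) :: real^'b^'b)"
  define Z where "Z = transpose C ** X ** D"
  have E: "(E ** A) $ a $ b = exp (s $ a) * A $ a $ b" for A :: "real^'b^'a" and a b
    by (simp add: E_def matrix_matrix_mult_def if_distrib[of "\<lambda>z. z * _"] cong: if_cong)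
  have F: "(A ** F) $ a $ b = A $ a $ b * exp (t $ b)" for A :: "real^'b^'a" and a b
    by (simp add: F_def matrix_matrix_mult_def if_distrib[of "\<lambda>z. _ * z"] cong: if_cong)
  have "trace (diag_exp C s ** (X ** diag_exp D t ** transpose X)) =
      trace (C ** (E ** transpose C ** X ** D ** F ** transpose D ** transpose X))"
    by (simp add: diag_exp_eq_matrix_product E_def F_def matrix_mul_assoc)
  also have "\<dots> = trace (E ** transpose C ** X ** D ** F ** transpose D ** transpose X ** C)"
    by (rule trace_mul_sym)
  also have "\<dots> = trace ((E ** Z) ** F ** transpose Z)"
    by (simp add: Z_def matrix_transpose_mul matrix_mul_assoc)
  also have "\<dots> = (\<Sum>a\<in>UNIV. \<Sum>b\<in>UNIV. ((E ** Z) ** F) $ a $ b * Z $ a $ b)"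
    by (simp add: trace_def matrix_matrix_mult_def[of "_ ** F"] transpose_def)
  also have "\<dots> = (\<Sum>a\<in>UNIV. \<Sum>b\<in>UNIV. exp (s $ a + t $ b) * (Z $ a $ b)\<^sup>2)"
    by (simp add: E F exp_add power2_eq_square mult_ac)
  finally show ?thesis by (simp add: Z_def)
qed

lemma loglik_diag_exp:
  fixes Y :: "nat \<Rightarrow> real^'b^'a"
  assumes "invertible C" "invertible D"
  shows "loglik n Y (diag_exp C s, diag_exp D t) =
     real n * real CARD('b) * (ln ((det C)\<^sup>2) + (\<Sum>a\<in>UNIV. s $ a)) +
     real n * real CARD('a) * (ln ((det D)\<^sup>2) + (\<Sum>b\<in>UNIV. t $ b)) -
     (\<Sum>a\<in>UNIV. \<Sum>b\<in>UNIV. exp (s $ a + t $ b) * weight n Y C D a b)"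
proof -
  have "trace (diag_exp C s ** (\<Sum>i<n. Y i ** diag_exp D t ** transpose (Y i))) =
     (\<Sum>i<n. trace (diag_exp C s ** (Y i ** diag_exp D t ** transpose (Y i))))"
    by (induction n) (simp_all add: matrix_add_ldistrib trace_add, simp add: trace_def)
  also have "\<dots> = (\<Sum>a\<in>UNIV. \<Sum>b\<in>UNIV. exp (s $ a + t $ b) * weight n Y C D a b)"
    unfolding trace_diag_exp_product weight_def sum_distrib_left
    by (subst sum.swap, intro sum.cong refl, rule sum.swap)
  finally show ?thesis
    using assms by (simp add: loglik_def det_diag_exp ln_mult invertible_det_nz)
qed

lemma exp_gt_one_plus: 
  assumes "(y::real) \<noteq> 0" shows "1 + y < exp y"
proof (cases "y \<ge> -2")
  case True
  have "(1 + y / 2) * (1 + y / 2) \<le> exp (y / 2) * exp (y / 2)"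
    using True exp_ge_add_one_self[of "y/2"] by (intro mult_mono) auto
  also have "exp (y / 2) * exp (y / 2) = exp y" by (simp flip: exp_add)
  finally have "1 + y + y\<^sup>2 / 4 \<le> exp y" by (simp add: algebra_simps power2_eq_square)
  moreover have "y\<^sup>2 / 4 > 0" using assms by simp
  ultimately show ?thesis by linarith
next
  case False
  then show ?thesis using exp_gt_zero[of y] by linarith
qed

lemma exp_below_chord:
  assumes "0 < \<theta>" "\<theta> < 1" "(x::real) \<noteq> 0"
  shows "exp (\<theta> * x) < 1 - \<theta> + \<theta> * exp x"
proof -
  have "exp (\<theta> * x) * (1 - \<theta> * x) < exp (\<theta> * x) * exp (- (\<theta> * x))"
    using exp_gt_one_plus[of "- (\<theta> * x)"] assms by simp
  then have 1: "exp (\<theta> * x) * (1 - \<theta> * x) < 1" by (simp flip: exp_add)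
  have "exp (\<theta> * x) * (1 + (1 - \<theta>) * x) < exp (\<theta> * x) * exp ((1 - \<theta>) * x)"
    using exp_gt_one_plus[of "(1 - \<theta>) * x"] assms by simp
  then have 2: "exp (\<theta> * x) * (1 + (1 - \<theta>) * x) < exp x" by (simp add: algebra_simps flip: exp_add)
  have "(1 - \<theta>) * (exp (\<theta> * x) * (1 - \<theta> * x)) + \<theta> * (exp (\<theta> * x) * (1 + (1 - \<theta>) * x))
      < (1 - \<theta>) * 1 + \<theta> * exp x"
    using 1 2 assms by (intro add_strict_mono mult_strict_left_mono) auto
  also have "(1 - \<theta>) * (exp (\<theta> * x) * (1 - \<theta> * x)) + \<theta> * (exp (\<theta> * x) * (1 + (1 - \<theta>) * x))
      = exp (\<theta> * x)"
    by (simp add: algebra_simps)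
  finally show ?thesis by simp
qed

lemma exp_le_chord:
  assumes "0 \<le> \<theta>" "\<theta> \<le> 1"
  shows "exp (\<theta> * (x::real)) \<le> 1 - \<theta> + \<theta> * exp x"
  using exp_below_chord[of \<theta> x] assms by (cases "\<theta> = 0 \<or> \<theta> = 1 \<or> x = 0") auto

text \<open>The negative log-likelihood in the frames \<open>C, D\<close>, up to a constant that vanishes for orthogonal frames:
  a nonnegative combination of exponentials of linear forms minus a linear form.\<close>

definition energy ::
  "nat \<Rightarrow> (nat \<Rightarrow> real^'b::finite^'a::finite) \<Rightarrow> real^'a^'a \<Rightarrow> real^'b^'b \<Rightarrow> real^'a \<Rightarrow> real^'b \<Rightarrow> real" where
  "energy n Y C D s t = (\<Sum>a\<in>UNIV. \<Sum>b\<in>UNIV. exp (s $ a + t $ b) * weight n Y C D a b) -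
     real n * (real CARD('b) * (\<Sum>a\<in>UNIV. s $ a) + real CARD('a) * (\<Sum>b\<in>UNIV. t $ b))"

lemma loglik_diag_exp_energy:
  fixes Y :: "nat \<Rightarrow> real^'b::finite^'a::finite"
  assumes "invertible C" "invertible D"
  shows "loglik n Y (diag_exp C s, diag_exp D t) = loglik n Y (diag_exp C 0, diag_exp D 0) + energy n Y C D 0 0 - energy n Y C D s t"
  using assms by (simp add: loglik_diag_exp energy_def algebra_simps)

lemma loglik_diag_exp_orthogonal:
  fixes Y :: "nat \<Rightarrow> real^'b::finite^'a::finite"
  assumes "orthogonal_matrix C" "orthogonal_matrix D"
  shows "loglik n Y (diag_exp C s, diag_exp D t) = - energy n Y C D s t"
proof -
  have "(det C)\<^sup>2 = 1" "(det D)\<^sup>2 = 1"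
    using det_orthogonal_matrix[OF assms(1)] det_orthogonal_matrix[OF assms(2)] by auto
  then show ?thesis
    using assms by (simp add: loglik_diag_exp orthogonal_matrix_invertible energy_def algebra_simps)
qed

text \<open>The linear part of the energy cancels, so the defect of convexity between parameters \<open>0\<close> and \<open>1\<close> is a
  weighted sum of the defects of the exponential function. Nonnegativity of the defect is convexity along
  rays; its vanishing will force \<open>s\<^sub>a + t\<^sub>b = 0\<close> wherever the weight is positive.\<close>

lemma energy_chord_gap:
  fixes Y :: "nat \<Rightarrow> real^'b::finite^'a::finite"
  shows "(1 - \<theta>) * energy n Y C D 0 0 + \<theta> * energy n Y C D s t - energy n Y C D (\<theta> *\<^sub>R s) (\<theta> *\<^sub>R t) =
    (\<Sum>a\<in>UNIV. \<Sum>b\<in>UNIV. (1 - \<theta> + \<theta> * exp (s $ a + t $ b) - exp (\<theta> * (s $ a + t $ b))) * weight n Y C D a b)"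
  by (simp add: energy_def algebra_simps sum.distrib sum_subtractf sum_distrib_left)

lemma energy_le_chord:
  fixes Y :: "nat \<Rightarrow> real^'b::finite^'a::finite"
  assumes "0 \<le> \<theta>" "\<theta> \<le> 1"
  shows "energy n Y C D (\<theta> *\<^sub>R s) (\<theta> *\<^sub>R t) \<le> (1 - \<theta>) * energy n Y C D 0 0 + \<theta> * energy n Y C D s t"
proof -
  have "0 \<le> (\<Sum>a\<in>UNIV. \<Sum>b\<in>UNIV. (1 - \<theta> + \<theta> * exp (s $ a + t $ b) - exp (\<theta> * (s $ a + t $ b))) * weight n Y C D a b)"
    by (intro sum_nonneg mult_nonneg_nonneg weight_nonneg) (simp add: exp_le_chord[OF assms])
  then show ?thesis unfolding energy_chord_gap[symmetric] by simp
qed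

lemma continuous_energy:
  fixes Y :: "nat \<Rightarrow> real^'b::finite^'a::finite"
  assumes "continuous_on X C" "continuous_on X D" "continuous_on X s" "continuous_on X t"
  shows "continuous_on X (\<lambda>x. energy n Y (C x) (D x) (s x) (t x))"
  unfolding energy_def weight_def matrix_matrix_mult_def transpose_def
  by (simp, intro continuous_intros assms)

section \<open>Stable samples\<close>

text \<open>The slope inequality \<open>dim V / m\<^sub>2 + dim W / m\<^sub>1 < 1\<close>, cleared of denominators. With \<open>W\<close> the orthogonal
  complement of \<open>\<Sum>\<^sub>i Y\<^sub>i V\<close> it says that the \<open>Y\<^sub>i\<close> together enlarge the relative dimension of every
  nonzero subspace \<open>V\<close> unless \<open>\<Sum>\<^sub>i Y\<^sub>i V\<close> is everything. This is the stability condition for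
  representations of the generalized Kronecker quiver.\<close>

definition stable_sample :: "nat \<Rightarrow> (nat \<Rightarrow> real^'b^'a) \<Rightarrow> bool" where
  "stable_sample n Y \<longleftrightarrow> (\<forall>V W. subspace V \<and> subspace W \<and> V \<noteq> {0} \<and> W \<noteq> {0} \<and>
     (\<forall>i<n. \<forall>v\<in>V. \<forall>w\<in>W. w \<bullet> (Y i *v v) = 0) \<longrightarrow>
     dim V * CARD('a) + dim W * CARD('b) < CARD('a) * CARD('b))"

lemma stable_sample_cong:
  "(\<And>i. i < n \<Longrightarrow> Y i = Z i) \<Longrightarrow> stable_sample n Y \<longleftrightarrow> stable_sample n Z"
  by (simp add: stable_sample_def)

lemma stable_sample_mono: "stable_sample m Y \<Longrightarrow> m \<le> n \<Longrightarrow> stable_sample n Y"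
  unfolding stable_sample_def by (meson order_less_le_trans)

lemma dim_coordinate_subspace: "dim {x::real^'n. \<forall>i. i \<notin> I \<longrightarrow> x $ i = 0} = card I"
  unfolding dim_vec_eq[symmetric] by (rule dim_substandard_cart)

lemma subspace_coordinates: "subspace {x::real^'n. \<forall>i. i \<notin> I \<longrightarrow> x $ i = 0}"
  by (auto simp: subspace_def)

text \<open>Stability of the sample, read off in frames \<open>C, D\<close>: sets of columns of \<open>C\<close> and \<open>D\<close> span
  subspaces to which the definition applies.\<close>

lemma stable_sample_support:
  fixes Y :: "nat \<Rightarrow> real^'b^'a"
  assumes "stable_sample n Y" and C: "invertible C" and D: "invertible D"
    and ne: "P \<noteq> {}" "T \<noteq> {}"
    and zero: "\<And>a b. a \<in> P \<Longrightarrow> b \<in> T \<Longrightarrow> weight n Y C D a b = 0"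
  shows "card T * CARD('a) + card P * CARD('b) < CARD('a) * CARD('b)"
proof -
  define V where "V = (\<lambda>x. D *v x) ` {x. \<forall>b. b \<notin> T \<longrightarrow> x $ b = 0}"
  define W where "W = (\<lambda>x. C *v x) ` {x. \<forall>a. a \<notin> P \<longrightarrow> x $ a = 0}"
  have inj: "inj ((*v) D)" "inj ((*v) C)"
    using C D inj_matrix_vector_mult by blast+
  have dims: "dim V = card T" "dim W = card P"
    unfolding V_def W_def using inj
    by (simp_all add: dim_image_eq dim_coordinate_subspace inj_on_subset)
  have "subspace V" "subspace W"
    unfolding V_def W_def
    by (intro linear_subspace_image matrix_vector_mul_linear subspace_coordinates)+
  moreover have "V \<noteq> {0}" "W \<noteq> {0}"
    using dims ne by (auto simp: card_eq_0_iff)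
  moreover have "w \<bullet> (Y i *v v) = 0" if "i < n" and v: "v \<in> V" and w: "w \<in> W" for i v w
  proof -
    obtain x where x: "v = D *v x" "\<And>b. b \<notin> T \<Longrightarrow> x $ b = 0" using v by (auto simp: V_def)
    obtain y where y: "w = C *v y" "\<And>a. a \<notin> P \<Longrightarrow> y $ a = 0" using w by (auto simp: W_def)
    let ?Z = "transpose C ** Y i ** D"
    have Z: "y $ a * (?Z $ a $ b * x $ b) = 0" for a b
      using x(2)[of b] y(2)[of a] zero[of a b] \<open>i < n\<close> unfolding weight_eq_0_iff
      by (cases "a \<in> P"; cases "b \<in> T"; simp)
    have "w \<bullet> (Y i *v v) = y \<bullet> (transpose C *v (Y i *v v))"
      unfolding y(1) by (metis dot_lmul_matrix transpose_matrix_vector transpose_transpose)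
    also have "transpose C *v (Y i *v v) = ?Z *v x"
      by (simp add: x(1) matrix_vector_mul_assoc matrix_mul_assoc)
    also have "y \<bullet> (?Z *v x) = 0"
      by (simp add: inner_vec_def matrix_vector_mult_def[of ?Z] sum_distrib_left Z)
    finally show ?thesis .
  qed
  ultimately have "dim V * CARD('a) + dim W * CARD('b) < CARD('a) * CARD('b)"
    using assms(1) unfolding stable_sample_def by blast
  then show ?thesis by (simp add: dims)
qed

section \<open>Existence and uniqueness of the maximum\<close>

text \<open>The rescalings \<open>s = -c, t = c\<close>, along which nothing grows, are excluded by the normalization
  \<open>\<Sum> t = 0\<close>. On any other ray either some exponential with positive weight blows up, or
  all exponents on the support are nonpositive and then the Hall inequality gives the linear term the right sign.\<close>

lemma stable_sample_ray_increases:
  fixes Y :: "nat \<Rightarrow> real^'b::finite^'a::finite"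
  assumes st: "stable_sample n Y" and n: "n > 0" and C: "invertible C" and D: "invertible D"
    and nz: "(s, t) \<noteq> (0, 0)" and norm: "(\<Sum>b\<in>UNIV. t $ b) = 0"
  obtains l where "l > 0" "energy n Y C D (l *\<^sub>R s) (l *\<^sub>R t) > energy n Y C D 0 0"
proof -
  define k where "k = real n * (real CARD('b) * (\<Sum>a\<in>UNIV. s $ a) + real CARD('a) * (\<Sum>b\<in>UNIV. t $ b))"
  define e0 where "e0 = energy n Y C D 0 0"
  have energy: "energy n Y C D (l *\<^sub>R s) (l *\<^sub>R t) =
      (\<Sum>a\<in>UNIV. \<Sum>b\<in>UNIV. exp (l * (s $ a + t $ b)) * weight n Y C D a b) - l * k" for l
    by (simp add: energy_def k_def algebra_simps sum_distrib_left)
  show thesis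
  proof (cases "\<exists>a b. weight n Y C D a b \<noteq> 0 \<and> s $ a + t $ b > 0")
    case True
    then obtain a b where ab: "weight n Y C D a b \<noteq> 0" "s $ a + t $ b > 0" by blast
    define x where "x = s $ a + t $ b"
    define w where "w = weight n Y C D a b"
    have pos: "x > 0" "w > 0" using ab weight_nonneg[of n Y C D a b] by (auto simp: x_def w_def)
    \<comment> \<open>The bound \<open>e\<^bsup>lx\<^esup> \<ge> (lx / 2)\<^sup>2\<close> is enough: \<open>l\<close> is chosen such that \<open>w (lx / 2)\<^sup>2\<close>
      exceeds \<open>e0 + l k\<close>.\<close>
    define l where "l = max 1 (4 * (\<bar>k\<bar> + \<bar>e0\<bar> + 1) / (w * x\<^sup>2))"
    have l: "l \<ge> 1" "4 * (\<bar>k\<bar> + \<bar>e0\<bar> + 1) / (w * x\<^sup>2) \<le> l" by (auto simp: l_def)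
    then have "4 * (\<bar>k\<bar> + \<bar>e0\<bar> + 1) \<le> l * (w * x\<^sup>2)"
      using pos by (simp add: pos_divide_le_eq)
    then have "l * (4 * (\<bar>k\<bar> + \<bar>e0\<bar> + 1)) \<le> l * (l * (w * x\<^sup>2))"
      using l by (intro mult_left_mono) auto
    moreover have "l * k \<le> l * \<bar>k\<bar>"
      using l by (intro mult_left_mono) auto
    moreover have "1 * (\<bar>e0\<bar> + 1) \<le> l * (\<bar>e0\<bar> + 1)"
      using l by (intro mult_right_mono) auto
    ultimately have lk: "e0 + l * k < w * (l * x / 2)\<^sup>2"
      by (simp add: algebra_simps power2_eq_square)
    have "l * x / 2 \<le> exp (l * x / 2)" 
      using exp_ge_add_one_self[of "l * x / 2"] by linarith
    then have "(l * x / 2)\<^sup>2 \<le> (exp (l * x / 2))\<^sup>2"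
      using l pos by (intro power_mono) auto
    also have "\<dots> = exp (l * x)" by (simp flip: exp_double)
    finally have "w * (l * x / 2)\<^sup>2 \<le> exp (l * x) * w" using pos by (simp add: mult.commute)
    also have "\<dots> \<le> (\<Sum>b\<in>UNIV. exp (l * (s $ a + t $ b)) * weight n Y C D a b)"
      unfolding w_def x_def by (rule member_le_sum) (auto simp: weight_nonneg)
    also have "\<dots> \<le> (\<Sum>a\<in>UNIV. \<Sum>b\<in>UNIV. exp (l * (s $ a + t $ b)) * weight n Y C D a b)"
      by (rule member_le_sum[of a]) (auto simp: weight_nonneg sum_nonneg)
    finally have "energy n Y C D (l *\<^sub>R s) (l *\<^sub>R t) > e0" using lk unfolding energy by linarith
    then show thesis using that[of l] l by (simp add: e0_def)
  next
    case False
    have hall: "real CARD('b) * sum (($) s) UNIV + real CARD('a) * sum (($) t) UNIV < 0 \<or>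
        (\<exists>c. (\<forall>a. s $ a = - c) \<and> (\<forall>b. t $ b = c))"
    proof (rule weighted_hall_inequality[where R = "\<lambda>a b. weight n Y C D a b \<noteq> 0"])
      show "card T * CARD('a) + card P * CARD('b) < CARD('a) * CARD('b)"
        if "P \<noteq> {}" "T \<noteq> {}" "\<And>a b. a \<in> P \<Longrightarrow> b \<in> T \<Longrightarrow> \<not> weight n Y C D a b \<noteq> 0" for P T
        using stable_sample_support[OF st C D that(1,2)] that(3) by blast
    qed (use False in \<open>auto simp: not_less\<close>)
    have "\<not> (\<exists>c. (\<forall>a. s $ a = - c) \<and> (\<forall>b. t $ b = c))"
    proof
      assume "\<exists>c. (\<forall>a. s $ a = - c) \<and> (\<forall>b. t $ b = c)"
      then obtain c where c: "\<And>a. s $ a = - c" "\<And>b. t $ b = c" by blast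
      then have "c = 0" using norm by simp
      then show False using c nz by (simp add: vec_eq_iff)
    qed
    then have k: "k < 0" using hall n unfolding k_def by (intro mult_pos_neg) auto
    define l where "l = (\<bar>e0\<bar> + 1) / - k"
    have "l > 0" "- l * k = \<bar>e0\<bar> + 1" using k by (simp_all add: l_def divide_pos_neg)
    moreover have "energy n Y C D (l *\<^sub>R s) (l *\<^sub>R t) \<ge> - l * k"
      unfolding energy by (simp add: sum_nonneg weight_nonneg)
    ultimately show thesis using that[of l] by (simp add: e0_def)
  qed
qed

lemma compact_orthogonal_matrices: "compact {C::real^'n^'n. orthogonal_matrix C}"
  unfolding compact_eq_bounded_closed
proof
  show "bounded {C::real^'n^'n. orthogonal_matrix C}"
    unfolding bounded_iff
  proof (intro exI ballI)
    fix C :: "real^'n^'n" assume "C \<in> {C. orthogonal_matrix C}"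
    then have "norm (C $ i) = 1" for i
      by (auto simp: orthogonal_matrix_orthonormal_rows row_def)
    then show "norm C \<le> real CARD('n)"
      using L2_set_le_sum[of UNIV "\<lambda>i. norm (C $ i)"] by (simp add: norm_vec_def)
  qed
  have "{C::real^'n^'n. orthogonal_matrix C} =
      {C. \<forall>i j. (\<Sum>k\<in>UNIV. C $ k $ i * C $ k $ j) = mat 1 $ i $ j}"
    by (auto simp: orthogonal_matrix matrix_matrix_mult_def transpose_def vec_eq_iff)
  also have "closed \<dots>"
    by (intro closed_Collect_all closed_Collect_eq continuous_intros)
  finally show "closed {C::real^'n^'n. orthogonal_matrix C}" .
qed

text \<open>Growth along single rays becomes uniform because the directions, namely two orthogonal frames and a
  unit vector \<open>(s, t)\<close>, form a compact set. In a limit direction of a sequence of counterexamples, the energy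
  exceeds its initial value at some parameter \<open>l\<close>; by continuity so it does along the sequence, and convexity
  carries this on to all larger parameters.\<close>

lemma stable_sample_coercive:
  fixes Y :: "nat \<Rightarrow> real^'b::finite^'a::finite"
  assumes st: "stable_sample n Y" and n: "n > 0"
  obtains T where "T > 0"
    "\<And>C D s t. orthogonal_matrix C \<Longrightarrow> orthogonal_matrix D \<Longrightarrow> (\<Sum>b\<in>UNIV. t $ b) = 0 \<Longrightarrow>
       norm (s, t) \<ge> T \<Longrightarrow> energy n Y C D s t > energy n Y C D 0 0"
proof (rule ccontr)
  assume contr: "\<not> thesis"
  have "\<forall>k. \<exists>C D s t. orthogonal_matrix C \<and> orthogonal_matrix D \<and> (\<Sum>b\<in>UNIV. t $ b) = 0 \<and>
       norm (s, t) \<ge> real (Suc k) \<and> energy n Y C D s t \<le> energy n Y C D 0 0"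
  proof (rule allI, rule ccontr)
    fix k
    assume none: "\<nexists>C D s t. orthogonal_matrix C \<and> orthogonal_matrix D \<and> (\<Sum>b\<in>UNIV. t $ b) = 0 \<and>
       norm (s, t) \<ge> real (Suc k) \<and> energy n Y C D s t \<le> energy n Y C D 0 0"
    have thesis
      by (rule that[of "real (Suc k)"]) (use none in \<open>auto simp: not_le[symmetric]\<close>)
    then show False using contr by contradiction
  qed
  then obtain C D s t where seq: "\<And>k. orthogonal_matrix (C k)" "\<And>k. orthogonal_matrix (D k)"
      "\<And>k. (\<Sum>b\<in>UNIV. t k $ b) = 0" "\<And>k. norm (s k, t k) \<ge> real (Suc k)"
      "\<And>k. energy n Y (C k) (D k) (s k) (t k) \<le> energy n Y (C k) (D k) 0 0"
    by metis
  define N where "N k = norm (s k, t k)" for k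
  have Npos: "N k > 0" for k using seq(4)[of k] unfolding N_def by linarith
  define u where "u k = (s k, t k) /\<^sub>R N k" for k
  define K where "K = {C::real^'a^'a. orthogonal_matrix C} \<times> {D::real^'b^'b. orthogonal_matrix D} \<times>
      (sphere 0 1 \<inter> {u::(real^'a) \<times> (real^'b). (\<Sum>b\<in>UNIV. snd u $ b) = 0})"
  have "compact K"
    unfolding K_def
    by (intro compact_Times compact_orthogonal_matrices compact_Int_closed compact_sphere
        closed_Collect_eq continuous_intros)
  define z where "z k = (C k, D k, u k)" for k
  have zK: "z k \<in> K" for k
  proof -
    have "norm (u k) = 1"
      unfolding u_def norm_scaleR using Npos[of k] by (simp flip: N_def)
    moreover have "(\<Sum>b\<in>UNIV. snd (u k) $ b) = 0"
      by (simp add: u_def seq(3) flip: sum_distrib_left)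
    ultimately show ?thesis using seq(1,2) by (simp add: K_def z_def)
  qed
  obtain x r where x: "x \<in> K" and r: "strict_mono (r :: nat \<Rightarrow> nat)" "(z \<circ> r) \<longlonglongrightarrow> x"
    using seq_compactE[OF compact_imp_seq_compact[OF \<open>compact K\<close>], of z] zK by blast
  obtain C0 D0 s0 t0 where x_eq: "x = (C0, D0, s0, t0)" by (metis prod.exhaust)
  have x0: "orthogonal_matrix C0" "orthogonal_matrix D0" "(\<Sum>b\<in>UNIV. t0 $ b) = 0" "(s0, t0) \<noteq> (0, 0)"
    using x by (auto simp: x_eq K_def)
  obtain l where l: "l > 0" "energy n Y C0 D0 (l *\<^sub>R s0) (l *\<^sub>R t0) > energy n Y C0 D0 0 0"
    by (rule stable_sample_ray_increases[OF st n orthogonal_matrix_invertible[OF x0(1)]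
          orthogonal_matrix_invertible[OF x0(2)] x0(4,3)])
  define h where "h y = energy n Y (fst y) (fst (snd y)) (l *\<^sub>R fst (snd (snd y))) (l *\<^sub>R snd (snd (snd y)))
      - energy n Y (fst y) (fst (snd y)) 0 0" for y
  have "continuous_on UNIV h"
    unfolding h_def by (intro continuous_intros continuous_energy)
  then have "isCont h x" by (simp add: continuous_on_eq_continuous_at x_eq)
  then have "(\<lambda>k. h ((z \<circ> r) k)) \<longlonglongrightarrow> h x"
    using isCont_tendsto_compose r(2) by blast
  moreover have "h x > 0" using l by (simp add: h_def x_eq)
  ultimately have "\<forall>\<^sub>F k in sequentially. h ((z \<circ> r) k) > 0"
    by (rule order_tendstoD)
  moreover have "\<forall>\<^sub>F k in sequentially. real k \<ge> l"
    by (rule eventually_at_top_linorderI[of "nat \<lceil>l\<rceil>"]) linarith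
  ultimately have "\<forall>\<^sub>F k in sequentially. h ((z \<circ> r) k) > 0 \<and> real k \<ge> l"
    by eventually_elim simp
  then obtain k where k: "h ((z \<circ> r) k) > 0" "real k \<ge> l"
    using eventually_happens'[OF sequentially_bot] by blast
  define j where "j = r k"
  have "k \<le> j" using r(1) by (simp add: j_def seq_suble)
  define \<theta> where "\<theta> = l / N j"
  have "l \<le> N j" using seq(4)[of j] k(2) \<open>k \<le> j\<close> unfolding N_def by linarith
  then have \<theta>: "0 \<le> \<theta>" "\<theta> \<le> 1" using l Npos[of j] by (auto simp: \<theta>_def)
  have "l *\<^sub>R fst (u j) = \<theta> *\<^sub>R s j" "l *\<^sub>R snd (u j) = \<theta> *\<^sub>R t j"
    by (simp_all add: u_def \<theta>_def divide_inverse)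
  then have "energy n Y (C j) (D j) 0 0 < energy n Y (C j) (D j) (\<theta> *\<^sub>R s j) (\<theta> *\<^sub>R t j)"
    using k(1) by (simp add: h_def j_def z_def)
  also have "\<dots> \<le> (1 - \<theta>) * energy n Y (C j) (D j) 0 0 + \<theta> * energy n Y (C j) (D j) (s j) (t j)"
    by (rule energy_le_chord[OF \<theta>])
  also have "\<dots> \<le> (1 - \<theta>) * energy n Y (C j) (D j) 0 0 + \<theta> * energy n Y (C j) (D j) 0 0"
    using \<theta> seq(5)[of j] by (intro add_left_mono mult_left_mono) auto
  finally show False by (simp add: algebra_simps)
qed

text \<open>The invariance under \<open>(\<Psi>\<^sub>1, \<Psi>\<^sub>2) \<mapsto> (e\<^sup>c \<Psi>\<^sub>1, e\<^bsup>-c\<^esup> \<Psi>\<^sub>2)\<close>, by which \<open>\<Sum> t = 0\<close> can be assumed.\<close>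

lemma energy_shift:
  fixes Y :: "nat \<Rightarrow> real^'b::finite^'a::finite"
  shows "energy n Y C D (s + (\<chi> a. c)) (t - (\<chi> b. c)) = energy n Y C D s t"
  by (simp add: energy_def sum.distrib sum_subtractf algebra_simps)

text \<open>After normalization, a minimum of the energy over orthogonal frames and \<open>(s, t)\<close> in a large ball is a global
  one: outside of the ball the energy exceeds its value at \<open>(0, 0)\<close> in the same frames.\<close>

theorem stable_sample_mle_exists:
  fixes Y :: "nat \<Rightarrow> real^'b::finite^'a::finite"
  assumes st: "stable_sample n Y" and n: "n > 0"
  shows "mle_exists n Y"
proof -
  obtain T where T: "T > 0" "\<And>C D s t. orthogonal_matrix C \<Longrightarrow> orthogonal_matrix D \<Longrightarrow>
      (\<Sum>b\<in>UNIV. t $ b) = 0 \<Longrightarrow> norm (s, t) \<ge> T \<Longrightarrow> energy n Y C D s t > energy n Y C D 0 0"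
    using stable_sample_coercive[OF st n] by blast
  define K where "K = {C::real^'a^'a. orthogonal_matrix C} \<times> {D::real^'b^'b. orthogonal_matrix D} \<times>
      cball (0 :: (real^'a) \<times> (real^'b)) T"
  define g where "g y = energy n Y (fst y) (fst (snd y)) (fst (snd (snd y))) (snd (snd (snd y)))" for y
  have "compact K"
    unfolding K_def by (intro compact_Times compact_orthogonal_matrices compact_cball)
  moreover have "(mat 1, mat 1, 0) \<in> K" using T(1) by (simp add: K_def orthogonal_matrix_id)
  moreover have "continuous_on K g"
    unfolding g_def by (intro continuous_intros continuous_energy)
  ultimately obtain x where x: "x \<in> K" "\<And>y. y \<in> K \<Longrightarrow> g x \<le> g y"
    using continuous_attains_inf[of K g] by blast
  obtain C0 D0 s0 t0 where x_eq: "x = (C0, D0, s0, t0)" by (metis prod.exhaust)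
  have orth0: "orthogonal_matrix C0" "orthogonal_matrix D0" using x(1) by (auto simp: x_eq K_def)
  have min: "energy n Y C0 D0 s0 t0 \<le> energy n Y C D s t"
    if C: "orthogonal_matrix C" and D: "orthogonal_matrix D" for C D s t
  proof -
    define c where "c = (\<Sum>b\<in>UNIV. t $ b) / real CARD('b)"
    define s' where "s' = s + (\<chi> a. c)"
    define t' where "t' = t - (\<chi> b. c)"
    have t': "(\<Sum>b\<in>UNIV. t' $ b) = 0" by (simp add: t'_def sum_subtractf c_def)
    have in_ball: "energy n Y C0 D0 s0 t0 \<le> energy n Y C D s'' t''" if "norm (s'', t'') \<le> T" for s'' t''
      using x(2)[of "(C, D, s'', t'')"] that C D by (simp add: K_def g_def x_eq)
    have "energy n Y C0 D0 s0 t0 \<le> energy n Y C D s' t'"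
    proof (cases "norm (s', t') \<le> T")
      case False
      then have "energy n Y C D 0 0 < energy n Y C D s' t'"
        by (intro T(2) C D t') auto
      moreover have "energy n Y C0 D0 s0 t0 \<le> energy n Y C D 0 0"
        using T(1) by (intro in_ball) (simp flip: zero_prod_def)
      ultimately show ?thesis by simp
    qed (rule in_ball)
    then show ?thesis by (simp add: s'_def t'_def energy_shift)
  qed
  have "loglik n Y \<Phi> \<le> loglik n Y (diag_exp C0 s0, diag_exp D0 t0)" if \<Phi>: "\<Phi> \<in> PD \<times> PD" for \<Phi>
  proof -
    obtain \<Phi>1 \<Phi>2 where P: "\<Phi> = (\<Phi>1, \<Phi>2)" "\<Phi>1 \<in> PD" "\<Phi>2 \<in> PD" using \<Phi> by auto
    obtain C s where C: "orthogonal_matrix C" "\<Phi>1 = diag_exp C s" by (rule PD_spectral_decomposition[OF P(2)])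
    obtain D t where D: "orthogonal_matrix D" "\<Phi>2 = diag_exp D t" by (rule PD_spectral_decomposition[OF P(3)])
    show ?thesis
      using min[OF C(1) D(1), of s t] by (simp add: P(1) C D orth0 loglik_diag_exp_orthogonal)
  qed
  moreover have "(diag_exp C0 s0, diag_exp D0 t0) \<in> PD \<times> PD"
    using orth0 by (simp add: diag_exp_in_PD orthogonal_matrix_invertible)
  ultimately show ?thesis unfolding mle_exists_def by blast
qed

lemma continuous_diag_exp:
  fixes C :: "real^'n^'n"
  assumes "continuous_on X t"
  shows "continuous_on X (\<lambda>x. diag_exp C (t x))"
  unfolding diag_exp_def by (intro continuous_intros assms)

lemma local_max_along_path:
  fixes g :: "real \<Rightarrow> 'c::topological_space"
  assumes "local_max_on f S (g 0)" "continuous_on UNIV g" "\<And>l. g l \<in> S"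
  obtains e where "e > 0" "\<And>l. 0 \<le> l \<Longrightarrow> l < e \<Longrightarrow> f (g l) \<le> f (g 0)"
proof -
  from assms(1) obtain U where U: "open U" "g 0 \<in> U" "\<And>y. y \<in> U \<Longrightarrow> y \<noteq> g 0 \<Longrightarrow> y \<in> S \<Longrightarrow> f y \<le> f (g 0)"
    unfolding local_max_on_def eventually_at_topological by blast
  have "open (g -` U)" using assms(2) U(1) by (simp add: open_vimage)
  then obtain e where e: "e > 0" "ball 0 e \<subseteq> g -` U"
    using U(2) by (metis open_contains_ball vimageI)
  have "f (g l) \<le> f (g 0)" if "0 \<le> l" "l < e" for l
  proof (cases "g l = g 0")
    case False
    have "l \<in> ball 0 e" using that by (simp add: dist_real_def)
    then have "g l \<in> U" using e(2) by blast
    then show ?thesis using U(3) assms(3) False by blast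
  qed simp
  then show thesis using that e(1) by blast
qed

text \<open>Two local maxima are the end points of a geodesic on which the energy \<open>f\<close> is convex. Local minimality at
  both ends forces \<open>f 0 = f 1\<close> and equality in the convexity inequality at some interior point, so
  \<open>s\<^sub>a + t\<^sub>b = 0\<close> on the support of the weights. Then the slope \<open>\<kappa>\<close> vanishes too, and the equality case of the
  Hall inequality shows that the two maxima differ by a rescaling, which the Kronecker product does not see.\<close>

theorem stable_sample_mle_exists_uniquely:
  fixes Y :: "nat \<Rightarrow> real^'b::finite^'a::finite"
  assumes st: "stable_sample n Y" and n: "n > 0"
  shows "mle_exists_uniquely n Y"
  unfolding mle_exists_uniquely_def
proof (intro conjI allI impI)
  show "mle_exists n Y" by (rule stable_sample_mle_exists[OF assms])
  fix \<Psi>1 :: "real^'a^'a" and \<Psi>2 :: "real^'b^'b" and \<Phi>1 \<Phi>2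
  assume max1: "local_max_on (loglik n Y) (PD \<times> PD) (\<Psi>1, \<Psi>2)"
    and max2: "local_max_on (loglik n Y) (PD \<times> PD) (\<Phi>1, \<Phi>2)"
  from max1 max2 have PD: "\<Psi>1 \<in> PD" "\<Psi>2 \<in> PD" "\<Phi>1 \<in> PD" "\<Phi>2 \<in> PD"
    by (auto simp: local_max_on_def)
  obtain C s where C: "invertible C" "\<Psi>1 = diag_exp C 0" "\<Phi>1 = diag_exp C s"
    by (rule PD_simultaneous_diagonalization[OF PD(1,3)])
  obtain D t where D: "invertible D" "\<Psi>2 = diag_exp D 0" "\<Phi>2 = diag_exp D t"
    by (rule PD_simultaneous_diagonalization[OF PD(2,4)])
  define f where "f l = energy n Y C D (l *\<^sub>R s) (l *\<^sub>R t)" for l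
  have ll: "loglik n Y (diag_exp C (l *\<^sub>R s), diag_exp D (l *\<^sub>R t)) = loglik n Y (diag_exp C 0, diag_exp D 0) + f 0 - f l" for l
    by (subst loglik_diag_exp_energy[OF C(1) D(1)]) (simp add: f_def)
  have chord: "f l \<le> (1 - l) * f 0 + l * f 1" if "0 \<le> l" "l \<le> 1" for l
    using energy_le_chord[OF that] by (simp add: f_def)
  have inPD: "(diag_exp C s', diag_exp D t') \<in> PD \<times> PD" for s' t'
    using C(1) D(1) by (simp add: diag_exp_in_PD)
  obtain e1 where e1: "e1 > 0" "\<And>l. 0 \<le> l \<Longrightarrow> l < e1 \<Longrightarrow> f 0 \<le> f l"
  proof -
    have "continuous_on UNIV (\<lambda>l. (diag_exp C (l *\<^sub>R s), diag_exp D (l *\<^sub>R t)))"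
      by (intro continuous_on_Pair continuous_diag_exp continuous_intros)
    with max1 obtain e where "e > 0" "\<And>l. 0 \<le> l \<Longrightarrow> l < e \<Longrightarrow>
        loglik n Y (diag_exp C (l *\<^sub>R s), diag_exp D (l *\<^sub>R t)) \<le> loglik n Y (diag_exp C (0 *\<^sub>R s), diag_exp D (0 *\<^sub>R t))"
      using local_max_along_path[of "loglik n Y" "PD \<times> PD" "\<lambda>l. (diag_exp C (l *\<^sub>R s), diag_exp D (l *\<^sub>R t))"] inPD
      by (auto simp: C(2) D(2))
    then show thesis unfolding ll by (intro that[of e]) auto
  qed
  obtain e2 where e2: "e2 > 0" "\<And>l. 0 \<le> l \<Longrightarrow> l < e2 \<Longrightarrow> f 1 \<le> f (1 - l)"
  proof -
    have "continuous_on UNIV (\<lambda>l. (diag_exp C ((1 - l) *\<^sub>R s), diag_exp D ((1 - l) *\<^sub>R t)))"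
      by (intro continuous_on_Pair continuous_diag_exp continuous_intros)
    with max2 obtain e where "e > 0" "\<And>l. 0 \<le> l \<Longrightarrow> l < e \<Longrightarrow>
        loglik n Y (diag_exp C ((1 - l) *\<^sub>R s), diag_exp D ((1 - l) *\<^sub>R t)) \<le> loglik n Y (diag_exp C ((1 - 0) *\<^sub>R s), diag_exp D ((1 - 0) *\<^sub>R t))"
      using local_max_along_path[of "loglik n Y" "PD \<times> PD" "\<lambda>l. (diag_exp C ((1 - l) *\<^sub>R s), diag_exp D ((1 - l) *\<^sub>R t))"] inPD
      by (auto simp: C(3) D(3))
    then show thesis unfolding ll by (intro that[of e]) auto
  qed
  \<comment> \<open>An interior parameter near enough to \<open>0\<close> for the first maximum, and with \<open>1 - \<theta>\<close> near enough to \<open>1\<close>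
    for the second.\<close>
  define \<theta> where "\<theta> = min (1/2) (min (e1/2) (e2/2))"
  have \<theta>: "0 < \<theta>" "\<theta> < 1" "\<theta> < e1" "\<theta> < e2" using e1(1) e2(1) by (auto simp: \<theta>_def)
  have "f 0 \<le> (1 - \<theta>) * f 0 + \<theta> * f 1" using e1(2)[of \<theta>] chord[of \<theta>] \<theta> by simp
  then have "\<theta> * f 0 \<le> \<theta> * f 1" by (simp add: algebra_simps)
  moreover have "f 1 \<le> (1 - (1 - \<theta>)) * f 0 + (1 - \<theta>) * f 1" using e2(2)[of \<theta>] chord[of "1 - \<theta>"] \<theta> by simp
  then have "\<theta> * f 1 \<le> \<theta> * f 0" by (simp add: algebra_simps)
  ultimately have f01: "f 1 = f 0" using \<theta> by simp
  have gap: "(\<Sum>a\<in>UNIV. \<Sum>b\<in>UNIV. (1 - \<theta> + \<theta> * exp (s $ a + t $ b) - exp (\<theta> * (s $ a + t $ b))) * weight n Y C D a b) \<le> 0"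
    using e1(2)[of \<theta>] \<theta> f01 unfolding energy_chord_gap[symmetric] by (simp add: f_def algebra_simps)
  have zero: "s $ a + t $ b = 0" if "weight n Y C D a b \<noteq> 0" for a b
  proof (rule ccontr)
    assume nz: "s $ a + t $ b \<noteq> 0"
    define d where "d a b = (1 - \<theta> + \<theta> * exp (s $ a + t $ b) - exp (\<theta> * (s $ a + t $ b))) * weight n Y C D a b" for a b
    have d: "d a b \<ge> 0" for a b
      using exp_le_chord[of \<theta> "s $ a + t $ b"] \<theta> by (simp add: d_def weight_nonneg)
    have "0 < d a b"
      unfolding d_def using exp_below_chord[OF \<theta>(1,2) nz] that weight_nonneg[of n Y C D a b]
      by (intro mult_pos_pos) (auto simp: order_less_le)
    also have "d a b \<le> (\<Sum>b\<in>UNIV. d a b)" by (rule member_le_sum) (auto simp: d)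
    also have "\<dots> \<le> (\<Sum>a\<in>UNIV. \<Sum>b\<in>UNIV. d a b)"
      by (rule member_le_sum[of a]) (auto simp: d sum_nonneg)
    finally show False using gap by (simp add: d_def)
  qed
  have "(\<Sum>a\<in>UNIV. \<Sum>b\<in>UNIV. exp (s $ a + t $ b) * weight n Y C D a b) =
      (\<Sum>a\<in>UNIV. \<Sum>b\<in>UNIV. weight n Y C D a b)"
  proof (intro sum.cong refl)
    show "exp (s $ a + t $ b) * weight n Y C D a b = weight n Y C D a b" for a b
      using zero[of a b] by (cases "weight n Y C D a b = 0") auto
  qed
  then have slope: "real CARD('b) * (\<Sum>a\<in>UNIV. s $ a) + real CARD('a) * (\<Sum>b\<in>UNIV. t $ b) = 0"
    using f01 n by (simp add: f_def energy_def)
  have "real CARD('b) * sum (($) s) UNIV + real CARD('a) * sum (($) t) UNIV < 0 \<or>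
        (\<exists>c. (\<forall>a. s $ a = - c) \<and> (\<forall>b. t $ b = c))"
  proof (rule weighted_hall_inequality[where R = "\<lambda>a b. weight n Y C D a b \<noteq> 0"])
    show "card T * CARD('a) + card P * CARD('b) < CARD('a) * CARD('b)"
      if "P \<noteq> {}" "T \<noteq> {}" "\<And>a b. a \<in> P \<Longrightarrow> b \<in> T \<Longrightarrow> \<not> weight n Y C D a b \<noteq> 0" for P T
      using stable_sample_support[OF st C(1) D(1) that(1,2)] that(3) by blast
  qed (simp add: zero)
  then obtain c where c: "\<And>a. s $ a = - c" "\<And>b. t $ b = c" using slope by auto
  show "kronecker \<Psi>2 \<Psi>1 = kronecker \<Phi>2 \<Phi>1"
  proof -
    have "\<Phi>1 $ i $ j = exp (- c) * \<Psi>1 $ i $ j" for i j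
      unfolding C(2,3) by (simp add: diag_exp_def c sum_distrib_left mult_ac)
    moreover have "\<Phi>2 $ i $ j = exp c * \<Psi>2 $ i $ j" for i j
      unfolding D(2,3) by (simp add: diag_exp_def c sum_distrib_left mult_ac)
    ultimately show ?thesis
      by (simp add: kronecker_def vec_eq_iff exp_minus)
  qed
qed

section \<open>Samples with too few columns\<close>

text \<open>Fewer than \<open>m\<^sub>1\<close> columns leave a unit vector orthogonal to all of them. In an orthogonal frame with this vector
  as column \<open>k\<close> the weights in row \<open>k\<close> vanish, so that \<open>s\<^sub>k = \<tau>\<close> can grow at no cost.\<close>

lemma loglik_unbounded_small_sample:
  fixes Y :: "nat \<Rightarrow> real^'b::finite^'a::finite"
  assumes n: "n > 0" and small: "n * CARD('b) < CARD('a)"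
  shows "\<not> loglik_bounded n Y"
proof
  assume "loglik_bounded n Y"
  then obtain B where B: "\<And>x. x \<in> PD \<times> PD \<Longrightarrow> loglik n Y x \<le> B"
    unfolding loglik_bounded_def bdd_above_def by (metis image_eqI)
  define S where "S = (\<lambda>(i, b). column b (Y i)) ` ({..<n} \<times> UNIV)"
  have "finite S" by (simp add: S_def)
  have "card S \<le> card ({..<n} \<times> (UNIV :: 'b set))"
    unfolding S_def by (rule card_image_le) simp
  then have "dim (span S) < DIM(real^'a)"
    using small dim_le_card'[OF \<open>finite S\<close>] by (simp add: card_cartesian_product)
  then obtain v where v: "v \<noteq> 0" "\<And>x. x \<in> span S \<Longrightarrow> orthogonal v x"
    by (metis orthogonal_to_subspace_exists dim_span span_span)
  fix k :: 'a
  have "norm (v /\<^sub>R norm v) = 1" using v(1) by simp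
  then obtain C where C: "orthogonal_matrix C" "C *v axis k 1 = v /\<^sub>R norm v"
    by (rule orthogonal_matrix_exists_basis)
  have Ck: "C $ l $ k = v $ l / norm v" for l
    using arg_cong[OF C(2), of "\<lambda>x. x $ l"]
    by (simp add: matrix_vector_mul_component axis_def matrix_vector_mult_def if_distrib divide_inverse_commute cong: if_cong)
  have wk: "weight n Y C (mat 1) k b = 0" for b
    unfolding weight_eq_0_iff
  proof (intro allI impI)
    fix i assume "i < n"
    then have "column b (Y i) \<in> span S" by (intro span_base) (auto simp: S_def)
    then have "v \<bullet> column b (Y i) = 0" using v(2) by (simp add: orthogonal_def)
    then show "(transpose C ** Y i ** mat 1) $ k $ b = 0"
      unfolding matrix_mul_rid
      by (simp add: matrix_matrix_mult_def transpose_def Ck inner_vec_def column_def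
          flip: sum_divide_distrib)
  qed
  define W where "W = (\<Sum>a\<in>UNIV. \<Sum>b\<in>UNIV. weight n Y C (mat 1) a b)"
  have ll: "loglik n Y (diag_exp C (axis k \<tau>), diag_exp (mat 1) 0) = real n * real CARD('b) * \<tau> - W" for \<tau>
  proof -
    have "exp (axis k \<tau> $ a) * weight n Y C (mat 1) a b = weight n Y C (mat 1) a b" for a b
      using wk by (cases "a = k") (auto simp: axis_def)
    then have "(\<Sum>a\<in>UNIV. \<Sum>b\<in>UNIV. exp (axis k \<tau> $ a) * weight n Y C (mat 1) a b) = W"
      by (simp only: W_def)
    moreover have "(\<Sum>a\<in>UNIV. axis k \<tau> $ a) = \<tau>"
      by (simp add: axis_def)
    ultimately show ?thesis
      using loglik_diag_exp_orthogonal[OF C(1) orthogonal_matrix_id, of n Y "axis k \<tau>" 0]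
      by (simp add: energy_def)
  qed
  have "(diag_exp C (axis k \<tau>), diag_exp (mat 1 :: real^'b^'b) 0) \<in> PD \<times> PD" for \<tau>
    using C(1) by (simp add: diag_exp_in_PD orthogonal_matrix_invertible orthogonal_matrix_id)
  from B[OF this] have "real n * real CARD('b) * \<tau> \<le> B + W" for \<tau>
    by (simp add: ll algebra_simps)
  from this[of "(B + W + 1) / (real n * real CARD('b))"] show False using n by simp
qed

section \<open>Unstable samples are negligible\<close>

text \<open>A basis of \<open>V\<close> in reduced echelon form, with pivot coordinates \<open>J\<close>. The nonpivot coordinates of its vectors,
  \<open>card J * card (- J)\<close> in number, parametrize the subspaces near \<open>V\<close> in the Grassmannian.\<close>

lemma subspace_reduced_basis:
  fixes V :: "(real^'n) set"
  assumes V: "subspace V"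
  shows "\<exists>J f. card J = dim V \<and> (\<forall>j\<in>J. f j \<in> V \<and> (\<forall>i\<in>J. f j $ i = (if i = j then 1 else 0)))"
proof -
  have "\<exists>J f. card J = k \<and> (\<forall>j\<in>J. f j \<in> V \<and> (\<forall>i\<in>J. f j $ i = (if i = j then 1 else 0)))"
    if "k \<le> dim V" for k
    using that
  proof (induction k)
    case 0
    show ?case by (intro exI[of _ "{}"]) simp
  next
    case (Suc k)
    then obtain J :: "'n set" and f where J: "card J = k"
      "\<And>j. j \<in> J \<Longrightarrow> f j \<in> V" "\<And>i j. j \<in> J \<Longrightarrow> i \<in> J \<Longrightarrow> f j $ i = (if i = j then 1 else 0)"
      by auto
    have "dim (f ` J) \<le> card (f ` J)" by (rule dim_le_card') simp
    also have "\<dots> \<le> k" using card_image_le[of J f] J(1) by simp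
    finally have "\<not> V \<subseteq> span (f ` J)"
      using Suc.prems by (metis dim_mono not_less_eq_eq order_trans)
    then obtain v where v: "v \<in> V" "v \<notin> span (f ` J)" by blast
    \<comment> \<open>Clearing the pivot coordinates of \<open>v\<close> leaves a nonzero vector, whose nonzero coordinates
      offer a new pivot.\<close>
    define w where "w = v - (\<Sum>j\<in>J. (v $ j) *\<^sub>R f j)"
    have "w \<in> V"
      unfolding w_def by (intro subspace_diff subspace_sum subspace_scale V v J)
    have "w \<noteq> 0"
    proof
      assume "w = 0"
      then have "v = (\<Sum>j\<in>J. (v $ j) *\<^sub>R f j)" by (simp add: w_def)
      also have "\<dots> \<in> span (f ` J)" by (intro span_sum span_scale span_base) auto
      finally show False using v(2) by blast
    qed
    have w0: "w $ i = 0" if "i \<in> J" for i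
    proof -
      have "(\<Sum>j\<in>J. v $ j * f j $ i) = (\<Sum>j\<in>J. if j = i then v $ i else 0)"
        using that J(3) by (intro sum.cong) auto
      then show ?thesis using that by (simp add: w_def)
    qed
    obtain m where m: "w $ m \<noteq> 0" using \<open>w \<noteq> 0\<close> by (auto simp: vec_eq_iff)
    then have "m \<notin> J" using w0 by blast
    define u where "u = w /\<^sub>R (w $ m)"
    define g where "g j = (if j = m then u else f j - (f j $ m) *\<^sub>R u)" for j
    have u: "u \<in> V" "u $ m = 1" "\<And>i. i \<in> J \<Longrightarrow> u $ i = 0"
      using \<open>w \<in> V\<close> m w0 by (auto simp: u_def subspace_scale[OF V])
    have "g j \<in> V" if "j \<in> insert m J" for j
      using that u(1) J(2) by (auto simp: g_def intro!: subspace_diff subspace_scale V)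
    moreover have "g j $ i = (if i = j then 1 else 0)" if "j \<in> insert m J" "i \<in> insert m J" for i j
      using that u J(3) \<open>m \<notin> J\<close> by (auto simp: g_def)
    moreover have "card (insert m J) = Suc k" using \<open>m \<notin> J\<close> J(1) by simp
    ultimately show ?case by (intro exI[of _ "insert m J"] exI[of _ g]) auto
  qed
  then show ?thesis by blast
qed

lemma real_polynomial_function_entry: "real_polynomial_function (\<lambda>x::real^'b^'a^'c. x $ i $ a $ b)"
  by (intro real_polynomial_function.intros(1) bounded_linear_compose[OF bounded_linear_vec_nth] bounded_linear_vec_nth)

lemma polynomial_function_tensor:
  fixes f :: "real^'b^'a^'c \<Rightarrow> real^'b^'a^'c"
  assumes "\<And>i a b. real_polynomial_function (\<lambda>x. f x $ i $ a $ b)"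
  shows "polynomial_function f"
  unfolding polynomial_function_iff_Basis_inner
  using assms by (auto simp: Basis_vec_def inner_axis)

text \<open>The vectors \<open>c p\<close> and \<open>d j\<close> are reduced bases with pivots \<open>P\<close> and \<open>J\<close>. The equation for \<open>(i, p, j)\<close> contains
  the entry \<open>x $ i $ p $ j\<close> with coefficient \<open>1\<close> and otherwise only entries outside of \<open>P \<times> J\<close>, so it can be solved
  for that entry. The \<open>card I * card P * card J\<close> entries that are determined in this way
  serve as storage for the free coordinates of \<open>c\<close> and \<open>d\<close>. As these are fewer, at least one cell stays unused:
  the set is contained in the image, under a polynomial self-map, of a coordinate hyperplane.\<close>

lemma negligible_bilinear_annihilation:
  fixes I :: "'c::finite set" and P :: "'a::finite set" and J :: "'b::finite set"
  assumes count: "card P * card (- P) + card J * card (- J) < card I * card P * card J"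
  shows "negligible {x :: real^'b^'a^'c. \<exists>c d.
      (\<forall>p\<in>P. \<forall>a\<in>P. c p $ a = (if a = p then 1 else 0)) \<and>
      (\<forall>j\<in>J. \<forall>b\<in>J. d j $ b = (if b = j then 1 else 0)) \<and>
      (\<forall>i\<in>I. \<forall>p\<in>P. \<forall>j\<in>J. (c p :: real^'a) \<bullet> (x $ i *v (d j :: real^'b)) = 0)}"
    (is "negligible ?Bad")
proof -
  have "I \<times> P \<times> J \<noteq> {}" using count by (auto simp: Sigma_empty_iff)
  then obtain i0 p0 j0 where o: "i0 \<in> I" "p0 \<in> P" "j0 \<in> J" by auto
  \<comment> \<open>Indices of the free coordinates of \<open>c\<close> and \<open>d\<close>; the injection \<open>h\<close> assigns them to cells and
    avoids \<open>(i0, p0, j0)\<close>.\<close>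
  define Q where "Q = (P \<times> - P) <+> (J \<times> - J)"
  have "card Q \<le> card (I \<times> P \<times> J - {(i0, p0, j0)})"
    using count o by (simp add: Q_def card_Plus card_cartesian_product card_Diff_singleton mult.assoc)
  then obtain h where h: "h ` Q \<subseteq> I \<times> P \<times> J - {(i0, p0, j0)}" "inj_on h Q"
    using card_le_inj[of Q "I \<times> P \<times> J - {(i0, p0, j0)}"] by (auto simp: Q_def)
  define get where "get x = (\<lambda>(i, a, b). x $ i $ a $ b)" for x :: "real^'b^'a^'c"
  \<comment> \<open>The reduced bases read back from the cells, and the entries solved from the equations.\<close>
  define cc where "cc x p a = (if a \<in> P then if a = p then 1 else 0 else get x (h (Inl (p, a))))" for x p a
  define dd where "dd x j b = (if b \<in> J then if b = j then 1 else 0 else get x (h (Inr (j, b))))" for x j b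
  define R where "R x i p j = (\<Sum>a\<in>UNIV. \<Sum>b\<in>UNIV.
     if a \<in> P \<and> b \<in> J then 0 else cc x p a * (x $ i $ a $ b * dd x j b))" for x i p j
  define f where "f x = (\<chi> i a b. if i \<in> I \<and> a \<in> P \<and> b \<in> J then - R x i a b else x $ i $ a $ b)" for x
  have poly_get: "real_polynomial_function (\<lambda>x. get x s)" for s
    by (cases s) (simp add: get_def real_polynomial_function_entry)
  have poly_if: "real_polynomial_function (\<lambda>x. if Z then u x else v x)"
    if "real_polynomial_function u" "real_polynomial_function v" for Z and u v :: "real^'b^'a^'c \<Rightarrow> real"
    using that by (cases Z) simp_all
  have "real_polynomial_function (\<lambda>x. f x $ i $ a $ b)" for i a b
    unfolding f_def R_def cc_def dd_def vec_lambda_beta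
    by (intro poly_if real_polynomial_function_minus real_polynomial_function_sum finite
        real_polynomial_function.intros(2,4) poly_get real_polynomial_function_entry)
  then have diff: "f differentiable_on {x. x $ i0 $ p0 $ j0 = 0}"
    by (intro differentiable_on_polynomial_function polynomial_function_tensor)
  have "negligible {x :: real^'b^'a^'c. axis i0 (axis p0 (axis j0 1)) \<bullet> x = 0}"
    by (rule negligible_hyperplane) (simp add: axis_eq_0_iff)
  then have "negligible {x :: real^'b^'a^'c. x $ i0 $ p0 $ j0 = 0}"
    by (simp add: inner_axis')
  from negligible_differentiable_image_negligible[OF order_refl this diff]
  have "negligible (f ` {x. x $ i0 $ p0 $ j0 = 0})" .
  moreover have "?Bad \<subseteq> f ` {x. x $ i0 $ p0 $ j0 = 0}"
  proof
    fix y assume "y \<in> ?Bad"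
    then obtain c :: "'a \<Rightarrow> real^'a" and d :: "'b \<Rightarrow> real^'b" where
      c: "\<And>p a. p \<in> P \<Longrightarrow> a \<in> P \<Longrightarrow> c p $ a = (if a = p then 1 else 0)" and
      d: "\<And>j b. j \<in> J \<Longrightarrow> b \<in> J \<Longrightarrow> d j $ b = (if b = j then 1 else 0)" and
      z: "\<And>i p j. i \<in> I \<Longrightarrow> p \<in> P \<Longrightarrow> j \<in> J \<Longrightarrow> c p \<bullet> (y $ i *v d j) = 0"
      by blast
    define val where "val q = (case q of Inl (p, a) \<Rightarrow> c p $ a | Inr (j, b) \<Rightarrow> d j $ b)" for q
    define slot where "slot s = (if s \<in> h ` Q then val (inv_into Q h s) else 0)" for s
    define x :: "real^'b^'a^'c" where
      "x = (\<chi> i a b. if i \<in> I \<and> a \<in> P \<and> b \<in> J then slot (i, a, b) else y $ i $ a $ b)"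
    have get_h: "get x (h q) = val q" if "q \<in> Q" for q
    proof -
      obtain i a b where s: "h q = (i, a, b)" by (metis prod.exhaust)
      have "(i, a, b) \<in> I \<times> P \<times> J" using h(1) that s by (metis Diff_iff image_subset_iff)
      then have "get x (h q) = slot (h q)" by (simp add: s get_def x_def)
      then show ?thesis using that h(2) by (simp add: slot_def)
    qed
    have cx: "cc x p a = c p $ a" if "p \<in> P" for p a
      using that c get_h[of "Inl (p, a)"] by (auto simp: cc_def Q_def val_def)
    have dx: "dd x j b = d j $ b" if "j \<in> J" for j b
      using that d get_h[of "Inr (j, b)"] by (auto simp: dd_def Q_def val_def)
    have "f x $ i $ p $ j = y $ i $ p $ j" for i p j
    proof (cases "i \<in> I \<and> p \<in> P \<and> j \<in> J")
      case True
      have "0 = (\<Sum>a\<in>UNIV. \<Sum>b\<in>UNIV. c p $ a * (y $ i $ a $ b * d j $ b))"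
        using z[of i p j] True by (simp add: inner_vec_def matrix_vector_mult_def sum_distrib_left)
      also have "\<dots> = (\<Sum>a\<in>UNIV. \<Sum>b\<in>UNIV. (if a = p then if b = j then y $ i $ p $ j else 0 else 0) +
          (if a \<in> P \<and> b \<in> J then 0 else cc x p a * (x $ i $ a $ b * dd x j b)))"
        using True c d cx dx by (intro sum.cong refl) (auto simp: x_def)
      also have "\<dots> = y $ i $ p $ j + R x i p j"
      proof -
        have "(\<Sum>b\<in>UNIV. if a = p then if b = j then y $ i $ p $ j else 0 else 0) =
            (if a = p then y $ i $ p $ j else 0)" for a
          by simp
        then show ?thesis by (simp add: sum.distrib R_def)
      qed
      finally show ?thesis using True by (simp add: f_def)
    qed (auto simp: f_def x_def)
    then have "y = f x" by (simp add: vec_eq_iff)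
    moreover have "x $ i0 $ p0 $ j0 = 0"
      using o h(1) by (auto simp: x_def slot_def)
    ultimately show "y \<in> f ` {x. x $ i0 $ p0 $ j0 = 0}" by blast
  qed
  ultimately show ?thesis by (rule negligible_subset)
qed

text \<open>Instability reads \<open>(m\<^sub>1 - p) m\<^sub>2 \<le> d m\<^sub>1\<close> and equally \<open>(m\<^sub>2 - d) m\<^sub>1 \<le> p m\<^sub>2\<close>; inserted into the left-hand side,
  these bound it by \<open>p d (m\<^sub>1 / m\<^sub>2 + m\<^sub>2 / m\<^sub>1)\<close>.\<close>

lemma stability_dimension_count:
  fixes d p m1 m2 n :: nat
  assumes d: "0 < d" "d \<le> m2" and p: "0 < p" "p \<le> m1"
    and unstable: "m1 * m2 \<le> d * m1 + p * m2" and n: "m1\<^sup>2 + m2\<^sup>2 < n * m1 * m2"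
  shows "p * (m1 - p) + d * (m2 - d) < n * p * d"
proof -
  have "m1 * m2 > 0" using d p by simp
  have "(m1 - p) * m2 \<le> d * m1" using unstable by (simp add: diff_mult_distrib)
  then have "p * m1 * ((m1 - p) * m2) \<le> p * m1 * (d * m1)" by (intro mult_left_mono) auto
  moreover have "(m2 - d) * m1 \<le> p * m2"
    using unstable unfolding diff_mult_distrib mult.commute[of m2 m1] by linarith
  then have "d * m2 * ((m2 - d) * m1) \<le> d * m2 * (p * m2)" by (intro mult_left_mono) auto
  ultimately have "(m1 * m2) * (p * (m1 - p) + d * (m2 - d)) \<le> p * d * (m1\<^sup>2 + m2\<^sup>2)"
    by (simp add: algebra_simps power2_eq_square)
  also have "\<dots> < p * d * (n * m1 * m2)" using d p n by simp
  also have "\<dots> = (m1 * m2) * (n * p * d)" by (simp add: mult_ac)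
  finally show ?thesis using \<open>m1 * m2 > 0\<close> by (simp only: mult_less_cancel1)
qed

text \<open>Only finitely many pairs of pivot sets occur, so a union bound over them suffices. The matrices of the
  sample are placed in an array indexed by a type \<open>'c\<close>, possibly with unused places, because a space whose
  dimension depends on \<open>n\<close> is not a type.\<close>

lemma negligible_unstable_samples:
  fixes g :: "nat \<Rightarrow> 'c::finite"
  assumes inj: "inj_on g {..<n}"
    and n: "(CARD('a))\<^sup>2 + (CARD('b))\<^sup>2 < n * CARD('a) * CARD('b)"
  shows "negligible {x :: real^'b::finite^'a::finite^'c. \<not> stable_sample n (\<lambda>i. x $ g i)}"
proof -
  define Bad where "Bad P J = {x :: real^'b^'a^'c. \<exists>c d.
      (\<forall>p\<in>P. \<forall>a\<in>P. c p $ a = (if a = p then 1 else 0)) \<and>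
      (\<forall>j\<in>J. \<forall>b\<in>J. d j $ b = (if b = j then 1 else 0)) \<and>
      (\<forall>i\<in>g ` {..<n}. \<forall>p\<in>P. \<forall>j\<in>J. (c p :: real^'a) \<bullet> (x $ i *v (d j :: real^'b)) = 0)}" for P J
  define \<T> where "\<T> = {(P :: 'a set, J :: 'b set). P \<noteq> {} \<and> J \<noteq> {} \<and>
      CARD('a) * CARD('b) \<le> card J * CARD('a) + card P * CARD('b)}"
  have "negligible (Bad P J)" if "(P, J) \<in> \<T>" for P J
    unfolding Bad_def
  proof (rule negligible_bilinear_annihilation)
    have "card P > 0" "card J > 0" using that by (auto simp: \<T>_def card_gt_0_iff)
    moreover have "card P \<le> CARD('a)" "card J \<le> CARD('b)" by (auto intro: card_mono)
    ultimately have "card P * (CARD('a) - card P) + card J * (CARD('b) - card J) < n * card P * card J"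
      using that n by (intro stability_dimension_count) (auto simp: \<T>_def)
    then show "card P * card (- P) + card J * card (- J) < card (g ` {..<n}) * card P * card J"
      by (simp add: card_image inj Compl_eq_Diff_UNIV card_Diff_subset)
  qed
  then have "negligible (\<Union>((\<lambda>(P, J). Bad P J) ` \<T>))"
    by (intro negligible_Union) auto
  moreover have "{x. \<not> stable_sample n (\<lambda>i. x $ g i)} \<subseteq> \<Union>((\<lambda>(P, J). Bad P J) ` \<T>)"
  proof
    fix x :: "real^'b^'a^'c" assume "x \<in> {x. \<not> stable_sample n (\<lambda>i. x $ g i)}"
    then have "\<exists>V W. (subspace V \<and> subspace W \<and> V \<noteq> {0} \<and> W \<noteq> {0} \<and>
        (\<forall>i<n. \<forall>v\<in>V. \<forall>w\<in>W. w \<bullet> (x $ g i *v v) = 0)) \<and>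
        CARD('a) * CARD('b) \<le> dim V * CARD('a) + dim W * CARD('b)"
      by (simp only: mem_Collect_eq stable_sample_def not_all not_imp not_less)
    then obtain V W where VW: "subspace V" "subspace W" "V \<noteq> {0}" "W \<noteq> {0}"
      "\<And>i v w. i < n \<Longrightarrow> v \<in> V \<Longrightarrow> w \<in> W \<Longrightarrow> w \<bullet> (x $ g i *v v) = 0"
      "CARD('a) * CARD('b) \<le> dim V * CARD('a) + dim W * CARD('b)"
      by blast
    obtain J d where J: "card J = dim V" "\<forall>j\<in>J. d j \<in> V \<and> (\<forall>b\<in>J. d j $ b = (if b = j then 1 else 0))"
      using subspace_reduced_basis[OF VW(1)] by blast
    obtain P c where P: "card P = dim W" "\<forall>p\<in>P. c p \<in> W \<and> (\<forall>a\<in>P. c p $ a = (if a = p then 1 else 0))"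
      using subspace_reduced_basis[OF VW(2)] by blast
    have "dim V \<noteq> 0" "dim W \<noteq> 0"
      using VW(1-4) subspace_0 by (auto simp: dim_eq_0)
    then have "(P, J) \<in> \<T>" using VW(6) J(1) P(1) by (auto simp: \<T>_def)
    moreover have "x \<in> Bad P J"
      unfolding Bad_def using J(2) P(2) VW(5) by blast
    ultimately show "x \<in> \<Union>((\<lambda>(P, J). Bad P J) ` \<T>)" by blast
  qed
  ultimately show ?thesis by (rule negligible_subset)
qed

section \<open>Absolute continuity of the matrix normal distribution\<close>

text \<open>A space \<open>'v\<close> that is the orthogonal sum of copies of \<open>'e\<close> indexed by \<open>I\<close>, with embeddings \<open>\<iota>\<close> and projections \<open>\<pi>\<close>,
  carries the product of the Lebesgue measures: boxes are products of boxes. It is applied both to arrays of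
  matrices and to matrices of reals.\<close>

lemma lborel_eq_distr_PiM:
  fixes \<pi> :: "'i \<Rightarrow> 'v::euclidean_space \<Rightarrow> 'e::euclidean_space" and \<iota> :: "'i \<Rightarrow> 'e \<Rightarrow> 'v"
  assumes fin: "finite I"
    and bij: "bij_betw (\<lambda>(k, b). \<iota> k b) (I \<times> Basis) Basis"
    and adj: "\<And>k b x. k \<in> I \<Longrightarrow> b \<in> Basis \<Longrightarrow> x \<bullet> \<iota> k b = \<pi> k x \<bullet> b"
    and meas: "\<Phi> \<in> measurable (PiM I (\<lambda>_. lborel)) borel"
    and sect: "\<And>Y k. k \<in> I \<Longrightarrow> \<pi> k (\<Phi> Y) = Y k"
  shows "lborel = distr (PiM I (\<lambda>_. lborel)) borel \<Phi>"
proof (rule lborel_eqI)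
  interpret product_sigma_finite "\<lambda>_. lborel :: 'e measure"
    by standard
  fix l u :: 'v assume le: "\<And>b. b \<in> Basis \<Longrightarrow> l \<bullet> b \<le> u \<bullet> b"
  have in_Basis: "\<iota> k b \<in> Basis" if "k \<in> I" "b \<in> Basis" for k b
    using bij that by (auto simp: bij_betw_def)
  have Basis: "Basis = (\<lambda>(k, b). \<iota> k b) ` (I \<times> Basis)"
    using bij by (simp add: bij_betw_def)
  have le': "\<pi> k l \<bullet> b \<le> \<pi> k u \<bullet> b" if "k \<in> I" "b \<in> Basis" for k b
    using le[OF in_Basis[OF that]] adj[OF that] by simp
  have box: "x \<in> box l u \<longleftrightarrow> (\<forall>k\<in>I. \<pi> k x \<in> box (\<pi> k l) (\<pi> k u))" for x
    unfolding mem_box by (subst Basis) (auto simp: adj)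
  have "\<Phi> -` box l u \<inter> space (PiM I (\<lambda>_. lborel)) = (\<Pi>\<^sub>E k\<in>I. box (\<pi> k l) (\<pi> k u))"
    by (auto simp: box sect space_PiM PiE_iff)
  then have "emeasure (distr (PiM I (\<lambda>_. lborel)) borel \<Phi>) (box l u) =
      (\<Prod>k\<in>I. emeasure lborel (box (\<pi> k l) (\<pi> k u)))"
    using meas fin by (simp add: emeasure_distr emeasure_PiM)
  also have "\<dots> = (\<Prod>k\<in>I. ennreal (\<Prod>b\<in>Basis. (\<pi> k u - \<pi> k l) \<bullet> b))"
    by (intro prod.cong refl emeasure_lborel_box le')
  also have "\<dots> = ennreal (\<Prod>k\<in>I. \<Prod>b\<in>Basis. (\<pi> k u - \<pi> k l) \<bullet> b)"
    by (intro prod_ennreal prod_nonneg) (auto simp: inner_diff_left le')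
  also have "(\<Prod>k\<in>I. \<Prod>b\<in>Basis. (\<pi> k u - \<pi> k l) \<bullet> b) = (\<Prod>(k, b)\<in>I \<times> Basis. (u - l) \<bullet> \<iota> k b)"
    unfolding prod.cartesian_product by (intro prod.cong refl) (auto simp: inner_diff_left adj)
  also have "\<dots> = (\<Prod>b\<in>Basis. (u - l) \<bullet> b)"
    using prod.reindex_bij_betw[OF bij, of "\<lambda>b. (u - l) \<bullet> b"] by (simp add: case_prod_beta)
  finally show "emeasure (distr (PiM I (\<lambda>_. lborel)) borel \<Phi>) (box l u) = (\<Prod>b\<in>Basis. (u - l) \<bullet> b)" .
qed simp

lemma PiM_density:
  assumes fin: "finite I" and sf: "sigma_finite_measure M" "sigma_finite_measure (density M f)"
    and f: "f \<in> borel_measurable M"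
  shows "density (PiM I (\<lambda>_. M)) (\<lambda>Y. \<Prod>i\<in>I. f (Y i)) = PiM I (\<lambda>_. density M f)"
proof -
  interpret M: product_sigma_finite "\<lambda>_. M" using sf(1) by (simp add: product_sigma_finite_def)
  interpret D: product_sigma_finite "\<lambda>_. density M f" using sf(2) by (simp add: product_sigma_finite_def)
  have prodf: "(\<lambda>Y. \<Prod>i\<in>I. f (Y i)) \<in> borel_measurable (PiM I (\<lambda>_. M))"
    by (intro borel_measurable_prod_ennreal measurable_compose[OF _ f] measurable_component_singleton)
  show ?thesis
  proof (rule D.PiM_eqI[OF fin])
    show "sets (density (PiM I (\<lambda>_. M)) (\<lambda>Y. \<Prod>i\<in>I. f (Y i))) = sets (PiM I (\<lambda>_. density M f))"
      by (simp cong: sets_PiM_cong)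
    fix A assume "\<And>i. i \<in> I \<Longrightarrow> A i \<in> sets (density M f)"
    then have A: "\<And>i. i \<in> I \<Longrightarrow> A i \<in> sets M" by simp
    have "emeasure (density (PiM I (\<lambda>_. M)) (\<lambda>Y. \<Prod>i\<in>I. f (Y i))) (Pi\<^sub>E I A) =
        (\<integral>\<^sup>+Y. (\<Prod>i\<in>I. f (Y i)) * indicator (Pi\<^sub>E I A) Y \<partial>PiM I (\<lambda>_. M))"
      by (intro emeasure_density prodf sets_PiM_I_finite fin A)
    also have "\<dots> = (\<integral>\<^sup>+Y. (\<Prod>i\<in>I. f (Y i) * indicator (A i) (Y i)) \<partial>PiM I (\<lambda>_. M))"
    proof (intro nn_integral_cong)
      fix Y assume "Y \<in> space (PiM I (\<lambda>_. M))"
      then have "Y \<in> extensional I" by (simp add: space_PiM PiE_def)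
      then have "indicator (Pi\<^sub>E I A) Y = (\<Prod>i\<in>I. indicator (A i) (Y i) :: ennreal)"
        using fin by (auto simp: indicator_def PiE_def Pi_def prod_zero_iff intro!: prod.neutral)
      then show "(\<Prod>i\<in>I. f (Y i)) * indicator (Pi\<^sub>E I A) Y = (\<Prod>i\<in>I. f (Y i) * indicator (A i) (Y i))"
        by (simp add: prod.distrib)
    qed
    also have "\<dots> = (\<Prod>i\<in>I. \<integral>\<^sup>+y. f y * indicator (A i) y \<partial>M)"
      using A f by (intro M.product_nn_integral_prod[OF fin]) auto
    also have "\<dots> = (\<Prod>i\<in>I. emeasure (density M f) (A i))"
      using A f by (intro prod.cong refl) (simp add: emeasure_density)
    finally show "emeasure (density (PiM I (\<lambda>_. M)) (\<lambda>Y. \<Prod>i\<in>I. f (Y i))) (Pi\<^sub>E I A) =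
        (\<Prod>i\<in>I. emeasure (density M f) (A i))" .
  qed
qed

lemma AE_PiM_density:
  assumes fin: "finite I" and sf: "sigma_finite_measure M" "sigma_finite_measure (density M f)"
    and f: "f \<in> borel_measurable M" and AE: "AE Y in PiM I (\<lambda>_. M). Q Y"
  shows "AE Y in PiM I (\<lambda>_. density M f). Q Y"
proof -
  have prodf: "(\<lambda>Y. \<Prod>i\<in>I. f (Y i)) \<in> borel_measurable (PiM I (\<lambda>_. M))"
    by (intro borel_measurable_prod_ennreal measurable_compose[OF _ f] measurable_component_singleton)
  show ?thesis
    unfolding PiM_density[OF fin sf f, symmetric] AE_density[OF prodf]
    using AE by eventually_elim simp
qed

lemma AE_PiM_absolutely_continuous:
  assumes fin: "finite I" and sf: "sigma_finite_measure M" "sigma_finite_measure N"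
    and ac: "absolutely_continuous M N" "sets N = sets M" and AE: "AE Y in PiM I (\<lambda>_. M). Q Y"
  shows "AE Y in PiM I (\<lambda>_. N). Q Y"
proof -
  interpret sigma_finite_measure M by fact
  have D: "density M (RN_deriv M N) = N" by (rule density_RN_deriv[OF ac])
  show ?thesis
    using AE_PiM_density[OF fin sf(1) _ borel_measurable_RN_deriv AE, of N] sf(2) unfolding D by blast
qed

text \<open>By Fubini, if a property of the coordinates in \<open>J\<close> holds almost everywhere on the larger product, then for almost every
  \<open>Y\<close> it holds for almost every choice of the other coordinates, on which it does not depend.\<close>

lemma AE_PiM_subset:
  assumes sf: "sigma_finite_measure M" and ne: "emeasure M (space M) \<noteq> 0"
    and J: "J \<subseteq> I" "finite I" and AE: "AE Y in PiM I (\<lambda>_. M). Q (restrict Y J)"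
  shows "AE Y in PiM J (\<lambda>_. M). Q Y"
proof -
  interpret product_sigma_finite "\<lambda>_. M" using sf by (simp add: product_sigma_finite_def)
  have fin: "finite J" "finite (I - J)" using J by (auto intro: finite_subset)
  interpret PJ: sigma_finite_measure "PiM J (\<lambda>_. M)" using fin(1) by (rule sigma_finite)
  interpret PK: sigma_finite_measure "PiM (I - J) (\<lambda>_. M)" using fin(2) by (rule sigma_finite)
  interpret pair_sigma_finite "PiM J (\<lambda>_. M)" "PiM (I - J) (\<lambda>_. M)" ..
  have U: "J \<union> (I - J) = I" using J by blast
  have "AE Z in distr (PiM J (\<lambda>_. M) \<Otimes>\<^sub>M PiM (I - J) (\<lambda>_. M)) (PiM (J \<union> (I - J)) (\<lambda>_. M)) (merge J (I - J)).
      Q (restrict Z J)"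
    unfolding distr_merge[OF Diff_disjoint fin] unfolding U by (rule AE)
  then have "AE Z in PiM J (\<lambda>_. M) \<Otimes>\<^sub>M PiM (I - J) (\<lambda>_. M). Q (restrict (merge J (I - J) Z) J)"
    by (rule AE_distrD[rotated]) (rule measurable_merge)
  from AE_pair[OF this]
  have *: "AE X in PiM J (\<lambda>_. M). AE Z in PiM (I - J) (\<lambda>_. M). Q (restrict X J)"
    by simp
  have "emeasure (PiM (I - J) (\<lambda>_. M)) (space (PiM (I - J) (\<lambda>_. M))) \<noteq> 0"
    using fin(2) ne unfolding space_PiM by (subst emeasure_PiM) (auto simp: prod_zero_iff)
  then have "ae_filter (PiM (I - J) (\<lambda>_. M)) \<noteq> bot"
    by (simp add: ae_filter_eq_bot_iff)
  with * have "AE X in PiM J (\<lambda>_. M). Q (restrict X J)"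
    by (auto simp: eventually_const)
  moreover have "AE X in PiM J (\<lambda>_. M). restrict X J = X"
    by (rule AE_I2) (simp add: space_PiM PiE_restrict)
  ultimately show ?thesis by eventually_elim simp
qed

lemma AE_lborel_if_negligible:
  assumes "negligible (S :: 'a::euclidean_space set)"
  shows "AE x in lborel. x \<notin> S"
proof -
  have "S \<in> null_sets (completion lborel)" using assms by (simp add: negligible_iff_null_sets)
  from AE_not_in[OF this] show ?thesis by (simp only: AE_completion_iff)
qed

lemma null_sets_lborel_if_negligible:
  "negligible S \<Longrightarrow> S \<in> sets borel \<Longrightarrow> S \<in> null_sets (lborel :: 'a::euclidean_space measure)"
  by (simp add: negligible_iff_null_sets null_sets_completion_iff)

lemma Basis_vec_bij_betw:
  assumes "bij_betw g I (UNIV :: 'c::finite set)"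
  shows "bij_betw (\<lambda>(k, b). axis (g k) b) (I \<times> Basis) (Basis :: ('e::euclidean_space^'c) set)"
proof -
  have "inj_on (\<lambda>(k, b). axis (g k) (b::'e)) (I \<times> Basis)"
    using assms by (auto simp: inj_on_def bij_betw_def axis_eq_axis)
  moreover have "(\<lambda>(k, b). axis (g k) (b::'e)) ` (I \<times> Basis) = Basis"
  proof -
    have "g ` I = UNIV" using assms by (simp add: bij_betw_def)
    moreover have "(\<lambda>(k, b). axis (g k) (b::'e)) ` (I \<times> Basis) = (\<Union>i\<in>g ` I. \<Union>b\<in>Basis. {axis i b})"
      by auto
    ultimately show ?thesis by (simp only: Basis_vec_def)
  qed
  ultimately show ?thesis by (simp add: bij_betw_def)
qed

lemma lborel_vec_eq_distr_PiM:
  assumes g: "bij_betw g I (UNIV :: 'c::finite set)" and fin: "finite I"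
  shows "(\<lambda>Y. \<chi> c. Y (inv_into I g c)) \<in> measurable (PiM I (\<lambda>_. lborel :: 'e::euclidean_space measure)) borel"
    and "lborel = distr (PiM I (\<lambda>_. lborel :: 'e measure)) borel (\<lambda>Y. \<chi> c. Y (inv_into I g c))"
proof -
  have "(\<lambda>Y. Y k) \<in> measurable (PiM I (\<lambda>_. lborel :: 'e measure)) borel" if "k \<in> I" for k
    using measurable_component_singleton[OF that, of "\<lambda>_. lborel :: 'e measure"] by simp
  moreover have "inv_into I g c \<in> I" for c
    using g by (simp add: bij_betw_def inv_into_into)
  ultimately have "(\<lambda>Y. Y (inv_into I g c) \<bullet> b) \<in> borel_measurable (PiM I (\<lambda>_. lborel :: 'e measure))" for c b
    by (intro borel_measurable_inner) auto
  then show meas: "(\<lambda>Y. \<chi> c. Y (inv_into I g c)) \<in> measurable (PiM I (\<lambda>_. lborel :: 'e measure)) borel"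
    by (subst borel_measurable_euclidean_space) (auto simp: Basis_vec_def inner_axis)
  show "lborel = distr (PiM I (\<lambda>_. lborel :: 'e measure)) borel (\<lambda>Y. \<chi> c. Y (inv_into I g c))"
  proof (rule lborel_eq_distr_PiM[OF fin Basis_vec_bij_betw[OF g], where \<pi> = "\<lambda>k x. x $ g k"])
    show "(\<chi> c. Y (inv_into I g c)) $ g k = Y k" if "k \<in> I" for Y k
      using g that by (simp add: bij_betw_def)
  qed (use meas in \<open>auto simp: inner_axis\<close>)
qed

lemma lborel_matrix_eq_distr_PiM:
  shows "(\<lambda>z. \<chi> i j. z (i, j)) \<in> measurable (PiM (UNIV :: ('a::finite \<times> 'b::finite) set) (\<lambda>_. lborel)) (borel :: (real^'b^'a) measure)"
    and "(lborel :: (real^'b^'a) measure) = distr (PiM (UNIV :: ('a \<times> 'b) set) (\<lambda>_. lborel)) borel (\<lambda>z. \<chi> i j. z (i, j))"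
proof -
  have "(\<lambda>z. z p) \<in> measurable (PiM (UNIV :: ('a \<times> 'b) set) (\<lambda>_. lborel)) (borel :: real measure)" for p
    using measurable_component_singleton[of p UNIV "\<lambda>_. lborel :: real measure"] by simp
  then show meas: "(\<lambda>z. \<chi> i j. z (i, j)) \<in> measurable (PiM (UNIV :: ('a \<times> 'b) set) (\<lambda>_. lborel)) (borel :: (real^'b^'a) measure)"
    by (subst borel_measurable_euclidean_space) (auto simp: Basis_vec_def inner_axis)
  show "(lborel :: (real^'b^'a) measure) = distr (PiM (UNIV :: ('a \<times> 'b) set) (\<lambda>_. lborel)) borel (\<lambda>z. \<chi> i j. z (i, j))"
  proof (rule lborel_eq_distr_PiM[where \<iota> = "\<lambda>p r. axis (fst p) (axis (snd p) r)" and \<pi> = "\<lambda>p x. x $ fst p $ snd p"])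
    show "bij_betw (\<lambda>(p, r). axis (fst p) (axis (snd p) r)) ((UNIV :: ('a \<times> 'b) set) \<times> (Basis :: real set)) (Basis :: (real^'b^'a) set)"
      unfolding bij_betw_def
    proof
      have "axis i (axis j 1) \<in> (\<lambda>(p, r). axis (fst p) (axis (snd p) r)) ` (UNIV \<times> {1::real})" for i :: 'a and j :: 'b
        by (rule image_eqI[of _ _ "((i, j), 1)"]) auto
      then show "(\<lambda>(p, r). axis (fst p) (axis (snd p) r)) ` ((UNIV :: ('a \<times> 'b) set) \<times> (Basis :: real set)) = (Basis :: (real^'b^'a) set)"
        unfolding Basis_vec_def by auto
    qed (auto simp: inj_on_def axis_eq_axis)
  qed (use meas in \<open>auto simp: inner_axis\<close>)
qed

lemma prob_space_std_normal: "prob_space (density lborel (\<lambda>x. ennreal (std_normal_density x)))"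
  by (rule prob_space_normal_density) simp

lemma sets_PiM_std_normal:
  "sets (PiM I (\<lambda>_. density lborel (\<lambda>x. ennreal (std_normal_density x)))) = sets (PiM I (\<lambda>_. lborel))"
  by (intro sets_PiM_cong) auto

lemma prob_space_std_normal_matrix: "prob_space (std_normal_matrix :: (real^'b::finite^'a::finite) measure)"
  unfolding std_normal_matrix_def
proof (rule prob_space.prob_space_distr)
  show "prob_space (PiM (UNIV :: ('a \<times> 'b) set) (\<lambda>_. density lborel (\<lambda>x. ennreal (std_normal_density x))))"
    by (intro prob_space_PiM prob_space_std_normal)
qed (use lborel_matrix_eq_distr_PiM(1) in \<open>simp add: measurable_cong_sets[OF sets_PiM_std_normal refl]\<close>)

text \<open>The Gaussian product measure has a density with respect to the product of Lebesgue measures.\<close>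

lemma null_sets_std_normal_matrix:
  assumes N: "N \<in> null_sets (lborel :: (real^'b::finite^'a::finite) measure)"
  shows "N \<in> null_sets std_normal_matrix"
proof -
  let ?G = "density lborel (\<lambda>x. ennreal (std_normal_density x))"
  let ?\<Phi> = "(\<lambda>z. \<chi> i j. z (i, j)) :: ('a \<times> 'b \<Rightarrow> real) \<Rightarrow> real^'b^'a"
  have meas: "?\<Phi> \<in> measurable (PiM UNIV (\<lambda>_. ?G)) borel"
    using lborel_matrix_eq_distr_PiM(1) by (simp add: measurable_cong_sets[OF sets_PiM_std_normal refl])
  have "AE x in distr (PiM (UNIV :: ('a \<times> 'b) set) (\<lambda>_. lborel)) borel ?\<Phi>. x \<notin> N"
    using AE_not_in[OF N] by (subst lborel_matrix_eq_distr_PiM(2)[symmetric])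
  then have "AE z in PiM UNIV (\<lambda>_. lborel). ?\<Phi> z \<notin> N"
    by (rule AE_distrD[OF lborel_matrix_eq_distr_PiM(1)])
  then have "AE z in PiM UNIV (\<lambda>_. ?G). ?\<Phi> z \<notin> N"
    by (intro AE_PiM_density sigma_finite_lborel prob_space_imp_sigma_finite prob_space_std_normal) auto
  then have "AE x in std_normal_matrix. x \<notin> N"
    unfolding std_normal_matrix_def using N
    by (subst AE_distr_iff[OF meas]) (auto simp: null_sets_def)
  moreover have "N \<in> sets std_normal_matrix"
    using N by (auto simp: std_normal_matrix_def null_sets_def)
  ultimately show ?thesis by (simp add: AE_iff_null_sets)
qed

lemma PD_factor_invertible:
  fixes A :: "real^'n^'n"
  assumes "A ** transpose A \<in> PD"
  shows "invertible A"
proof -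
  have "x = 0" if "transpose A *v x = 0" for x
  proof (rule ccontr)
    assume "x \<noteq> 0"
    then have "x \<bullet> ((A ** transpose A) *v x) > 0" using assms by (auto simp: PD_def)
    then show False using that by (simp flip: matrix_vector_mul_assoc)
  qed
  then have "\<exists>B. B ** transpose A = mat 1" by (simp add: matrix_left_invertible_ker)
  then have "invertible (transpose A)" by (simp add: invertible_left_inverse)
  then show ?thesis using transpose_invertible[of "transpose A"] by simp
qed

lemma linear_matrix_sandwich:
  fixes A :: "real^'a^'c" and B :: "real^'d^'b"
  shows "linear (\<lambda>Z :: real^'b^'a. A ** Z ** B)"
proof -
  have "linear (\<lambda>Z :: real^'b^'a. A ** Z)"
    by (rule linearI)
       (simp_all add: vec_eq_iff matrix_matrix_mult_def distrib_left sum.distrib sum_distrib_left mult.left_commute)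
  moreover have "linear (\<lambda>Z :: real^'b^'c. Z ** B)"
    by (rule linearI)
       (simp_all add: vec_eq_iff matrix_matrix_mult_def distrib_right sum.distrib sum_distrib_left mult.assoc)
  ultimately show ?thesis
    using linear_compose[of "\<lambda>Z. A ** Z" "\<lambda>Z. Z ** B"] unfolding o_def by blast
qed

text \<open>Nonsingular covariances make the factors \<open>A, B\<close> invertible, so \<open>Z \<mapsto> A Z B\<^sup>T\<close> is a linear isomorphism, and
  preimages of null sets under it are null sets.\<close>

lemma matrix_normal_absolutely_continuous:
  fixes \<mu> :: "(real^'b::finite^'a::finite) measure"
  assumes S: "S1 \<in> PD" "S2 \<in> PD" and \<mu>: "matrix_normal S1 S2 \<mu>"
  shows "prob_space \<mu>" "sets \<mu> = sets borel" "absolutely_continuous lborel \<mu>"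
proof -
  obtain A :: "real^'a^'a" and B :: "real^'b^'b" where AB: "S1 = A ** transpose A" "S2 = B ** transpose B"
    and \<mu>_eq: "\<mu> = distr std_normal_matrix borel (\<lambda>Z. A ** Z ** transpose B)"
    using \<mu> unfolding matrix_normal_def by blast
  define L where "L Z = A ** Z ** transpose B" for Z :: "real^'b^'a"
  have "invertible A" "invertible (transpose B)"
    using S by (simp_all add: AB PD_factor_invertible transpose_invertible)
  then obtain A' B' where inv: "A ** A' = mat 1" "A' ** A = mat 1"
      "transpose B ** B' = mat 1" "B' ** transpose B = mat 1"
    unfolding invertible_def by blast
  define L' where "L' Z = A' ** Z ** B'" for Z :: "real^'b^'a"
  have L'L: "L' (L Z) = Z" for Z
  proof -
    have "L' (L Z) = (A' ** A) ** Z ** (transpose B ** B')" by (simp only: L_def L'_def matrix_mul_assoc)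
    then show ?thesis by (simp add: inv)
  qed
  have lin: "linear L" "linear L'"
    using linear_matrix_sandwich[of A "transpose B"] linear_matrix_sandwich[of A' B']
    by (simp_all add: L_def[abs_def] L'_def[abs_def])
  have L_meas: "L \<in> measurable borel borel"
    by (intro borel_measurable_continuous_onI linear_continuous_on linear_conv_bounded_linear[THEN iffD1, OF lin(1)])
  have sets_std: "sets std_normal_matrix = sets (borel :: (real^'b^'a) measure)"
    by (simp add: std_normal_matrix_def)
  then have L_meas': "L \<in> measurable std_normal_matrix borel"
    using L_meas measurable_cong_sets[OF sets_std refl] by blast
  have \<mu>L: "\<mu> = distr std_normal_matrix borel L" by (simp add: \<mu>_eq L_def[abs_def])
  show "prob_space \<mu>"
    unfolding \<mu>L by (rule prob_space.prob_space_distr[OF prob_space_std_normal_matrix L_meas'])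
  show "sets \<mu> = sets borel" by (simp add: \<mu>L)
  show "absolutely_continuous lborel \<mu>"
    unfolding absolutely_continuous_def
  proof
    fix N assume N: "N \<in> null_sets (lborel :: (real^'b^'a) measure)"
    then have Nb: "N \<in> sets borel" by (auto simp: null_sets_def)
    have "negligible N" using N by (simp add: negligible_iff_null_sets null_sets_completionI)
    then have "negligible (L' ` N)"
      by (intro negligible_differentiable_image_negligible order_refl
          linear_imp_differentiable_on lin(2))
    moreover have "L -` N \<subseteq> L' ` N" using L'L by (metis image_eqI subsetI vimageD)
    ultimately have "negligible (L -` N)" by (rule negligible_subset)
    moreover have "L -` N \<in> sets borel" using measurable_sets[OF L_meas Nb] by simp
    ultimately have "L -` N \<in> null_sets std_normal_matrix"
      by (intro null_sets_std_normal_matrix null_sets_lborel_if_negligible)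
    moreover have "space std_normal_matrix = (UNIV :: (real^'b^'a) set)"
      by (simp add: std_normal_matrix_def)
    ultimately show "N \<in> null_sets \<mu>"
      unfolding \<mu>L using Nb L_meas' by (simp add: null_sets_def emeasure_distr)
  qed
qed

text \<open>The sample is extended to one of size \<open>CARD('a)\<close>, which can be regarded as an array indexed by \<open>'a\<close> itself.\<close>

lemma AE_lborel_stable_sample:
  assumes N: "N \<le> CARD('a)" and count: "(CARD('a))\<^sup>2 + (CARD('b))\<^sup>2 < N * CARD('a) * CARD('b)"
  shows "AE Y in PiM {..<N} (\<lambda>_. lborel :: (real^'b::finite^'a::finite) measure). stable_sample N Y"
proof (rule AE_PiM_subset[OF sigma_finite_lborel])
  let ?I = "{..<CARD('a)}"
  obtain g where g: "bij_betw g ?I (UNIV :: 'a set)"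
    using ex_bij_betw_nat_finite[of "UNIV :: 'a set"] by (auto simp: atLeast0LessThan)
  let ?\<Phi> = "\<lambda>Y. \<chi> c. (Y (inv_into ?I g c) :: real^'b^'a)"
  have inj: "inj_on g {..<N}" using g N by (auto simp: bij_betw_def intro: inj_on_subset)
  have "AE x in lborel. x \<notin> {x :: real^'b^'a^'a. \<not> stable_sample N (\<lambda>i. x $ g i)}"
    by (intro AE_lborel_if_negligible negligible_unstable_samples inj count)
  then have "AE x in distr (PiM ?I (\<lambda>_. lborel)) borel ?\<Phi>. stable_sample N (\<lambda>i. x $ g i)"
    by (subst lborel_vec_eq_distr_PiM(2)[OF g finite_lessThan, symmetric]) simp
  then have "AE Y in PiM ?I (\<lambda>_. lborel). stable_sample N (\<lambda>i. ?\<Phi> Y $ g i)"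
    by (rule AE_distrD[OF lborel_vec_eq_distr_PiM(1)[OF g finite_lessThan]])
  moreover have "stable_sample N (\<lambda>i. ?\<Phi> Y $ g i) \<longleftrightarrow> stable_sample N (restrict Y {..<N})" for Y
    using g N by (intro stable_sample_cong) (simp add: bij_betw_def)
  ultimately show "AE Y in PiM ?I (\<lambda>_. lborel :: (real^'b^'a) measure). stable_sample N (restrict Y {..<N})"
    by simp
qed (use N in auto)

text \<open>The first \<open>N\<close> matrices already make the sample stable, since further matrices only add constraints on the pairs
  \<open>V, W\<close>.\<close>

theorem AE_stable_sample:
  fixes \<mu> :: "(real^'b::finite^'a::finite) measure"
  assumes \<mu>: "prob_space \<mu>" "sets \<mu> = sets borel" "absolutely_continuous lborel \<mu>"
    and N: "N \<le> CARD('a)" "(CARD('a))\<^sup>2 + (CARD('b))\<^sup>2 < N * CARD('a) * CARD('b)" and n: "N \<le> n"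
  shows "AE Y in PiM {..<n} (\<lambda>_. \<mu>). stable_sample n Y"
proof -
  interpret \<mu>: prob_space \<mu> by fact
  interpret product_prob_space "\<lambda>_. \<mu>" "{..<n}" by unfold_locales
  have sub: "{..<N} \<subseteq> {..<n}" using n by auto
  have "AE Y in PiM {..<N} (\<lambda>_. \<mu>). stable_sample N Y"
    by (rule AE_PiM_absolutely_continuous[OF finite_lessThan sigma_finite_lborel \<mu>.sigma_finite_measure_axioms \<mu>(3)])
       (simp_all add: \<mu>(2) AE_lborel_stable_sample[OF N])
  moreover have "PiM {..<N} (\<lambda>_. \<mu>) = distr (PiM {..<n} (\<lambda>_. \<mu>)) (PiM {..<N} (\<lambda>_. \<mu>)) (\<lambda>Y. restrict Y {..<N})"
    by (rule distr_restrict[OF sub finite_lessThan])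
  ultimately have "AE Y in distr (PiM {..<n} (\<lambda>_. \<mu>)) (PiM {..<N} (\<lambda>_. \<mu>)) (\<lambda>Y. restrict Y {..<N}). stable_sample N Y"
    by metis
  then have "AE Y in PiM {..<n} (\<lambda>_. \<mu>). stable_sample N (restrict Y {..<N})"
    by (rule AE_distrD[OF measurable_restrict_subset[OF sub]])
  then show ?thesis
  proof eventually_elim
    case (elim Y)
    then have "stable_sample N Y" using stable_sample_cong[of N "restrict Y {..<N}" Y] by simp
    then show ?case using n by (rule stable_sample_mono)
  qed
qed

section \<open>The thresholds\<close>

text \<open>With \<open>d = m2 - r\<close> one has \<open>(k + 1) m2 = m1 + d\<close>, so the last inequality is \<open>m2\<^sup>2 < m1 d\<close>, which amounts to
  \<open>m2 d + r\<^sup>2 < k m2 d\<close>. This is the first alternative of the hypothesis with denominators cleared; in the second one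
  \<open>k \<ge> m2\<close>, and \<open>m2 d + r\<^sup>2 < m2\<^sup>2 d\<close> follows from \<open>r < m2\<close>.\<close>

lemma threshold_sample_size_bounds:
  fixes m1 m2 r :: nat
  assumes "m1 > m2" and "m2 \<ge> 2" and "r = m1 mod m2" and "r \<ge> 1"
    and "real (m1 div m2) > 1 + (real r)\<^sup>2 / (real m2 * (real m2 - real r)) \<or> m1 \<ge> m2\<^sup>2"
  shows "(m1 div m2) * m2 < m1" "m1 div m2 + 1 \<le> m1" "m1\<^sup>2 + m2\<^sup>2 < (m1 div m2 + 1) * m1 * m2"
proof -
  define k where "k = m1 div m2"
  have m1: "m1 = k * m2 + r" using assms(3) by (simp add: k_def)
  have r: "r < m2" using assms(2,3) by simp
  show "(m1 div m2) * m2 < m1" using m1 assms(4) by (simp add: k_def)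
  show "m1 div m2 + 1 \<le> m1" using assms(1,2) by (simp add: Suc_le_eq)
  define d where "d = m2 - r"
  have d: "d \<ge> 1" "m2 = d + r" using r by (auto simp: d_def)
  have key: "k * (m2 * d) > m2 * d + r\<^sup>2"
    using assms(5)
  proof
    assume "real (m1 div m2) > 1 + (real r)\<^sup>2 / (real m2 * (real m2 - real r))"
    then have "real k > 1 + (real r)\<^sup>2 / (real m2 * real d)" using d(2) by (simp add: k_def)
    moreover define X where "X = real m2 * real d"
    moreover have X: "X > 0" using d assms(2) by (simp add: X_def)
    ultimately have "real k * X > (1 + (real r)\<^sup>2 / X) * X"
      by (intro mult_strict_right_mono) simp_all
    also have "(1 + (real r)\<^sup>2 / X) * X = X + (real r)\<^sup>2"
      using X by (simp add: distrib_right)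
    finally have "real (m2 * d + r\<^sup>2) < real (k * (m2 * d))" by (simp add: X_def)
    then show ?thesis by (simp only: of_nat_less_iff)
  next
    assume "m1 \<ge> m2\<^sup>2"
    then have "m2 \<le> k" using assms(2) by (simp add: k_def less_eq_div_iff_mult_less_eq power2_eq_square)
    then have "m2 * (m2 * d) \<le> k * (m2 * d)" by (rule mult_right_mono) simp
    moreover have "m2 * d + r\<^sup>2 < m2 * (m2 * d)"
    proof -
      obtain e where e: "d = Suc e" using d(1) by (metis One_nat_def Suc_le_D)
      show ?thesis unfolding d(2) e using assms(4)
        by (simp add: algebra_simps power2_eq_square)
    qed
    ultimately show ?thesis by linarith
  qed
  have "m1\<^sup>2 + m2\<^sup>2 < (k + 1) * m1 * m2"
  proof -
    have "(k + 1) * m2 = m1 + d" using m1 d(2) by (simp add: algebra_simps)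
    moreover have "(k + 1) * m1 * m2 = m1 * ((k + 1) * m2)" by (simp only: mult_ac)
    ultimately have "(k + 1) * m1 * m2 = m1\<^sup>2 + m1 * d"
      by (simp only: distrib_left power2_eq_square)
    moreover have "m2\<^sup>2 < m1 * d"
    proof -
      have "m1 * d = k * (m2 * d) + r * d" unfolding m1 by (simp add: algebra_simps)
      moreover have "m2\<^sup>2 = m2 * d + r\<^sup>2 + r * d" unfolding d(2) by (simp add: algebra_simps power2_eq_square)
      ultimately show ?thesis using key by simp
    qed
    ultimately show ?thesis by simp
  qed
  then show "m1\<^sup>2 + m2\<^sup>2 < (m1 div m2 + 1) * m1 * m2" by (simp add: k_def)
qed

lemma mle_exists_imp_bounded: "mle_exists n Y \<Longrightarrow> loglik_bounded n Y"
  unfolding mle_exists_def loglik_bounded_def bdd_above_def by blast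

text \<open>The three properties of the likelihood lie between stability and boundedness, so they share the threshold.\<close>

lemma is_threshold_if_stable:
  fixes P :: "nat \<Rightarrow> (nat \<Rightarrow> real^'b::finite^'a::finite) \<Rightarrow> bool"
  assumes stable: "\<And>n Y. stable_sample n Y \<Longrightarrow> n > 0 \<Longrightarrow> P n Y"
    and bounded: "\<And>n Y. P n Y \<Longrightarrow> loglik_bounded n Y"
    and N: "N \<ge> 1" "N \<le> CARD('a)" "(CARD('a))\<^sup>2 + (CARD('b))\<^sup>2 < N * CARD('a) * CARD('b)"
    and small: "(N - 1) * CARD('b) < CARD('a)"
  shows "is_threshold P N"
  unfolding is_threshold_def
proof (intro conjI ballI allI impI)
  fix S1 :: "real^'a^'a" and S2 :: "real^'b^'b" and \<mu> :: "(real^'b^'a) measure" and n :: nat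
  assume "S1 \<in> PD" "S2 \<in> PD" "matrix_normal S1 S2 \<mu>" and n: "n \<ge> 1"
  note \<mu> = matrix_normal_absolutely_continuous[OF this(1-3)]
  interpret prob_space "PiM {..<n} (\<lambda>_. \<mu>)" using \<mu>(1) by (intro prob_space_PiM)
  show "(AE Y in PiM {..<n} (\<lambda>_. \<mu>). P n Y) \<longleftrightarrow> N \<le> n"
  proof
    assume "N \<le> n"
    from AE_stable_sample[OF \<mu> N(2,3) this] show "AE Y in PiM {..<n} (\<lambda>_. \<mu>). P n Y"
      by eventually_elim (use stable n in simp)
  next
    assume AE: "AE Y in PiM {..<n} (\<lambda>_. \<mu>). P n Y"
    show "N \<le> n"
    proof (rule ccontr)
      assume "\<not> N \<le> n"
      then have "n * CARD('b) \<le> (N - 1) * CARD('b)" by (intro mult_right_mono) auto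
      then have "n * CARD('b) < CARD('a)" using small by linarith
      then have "\<not> P n Y" for Y
        using bounded[of n Y] loglik_unbounded_small_sample[of n Y] n by auto
      then show False using AE by simp
    qed
  qed
qed (use N in simp)

theorem corollary1p5:
  fixes m1 m2 r :: nat
  assumes "CARD('a::finite) = m1" and "CARD('b::finite) = m2"
    and "m1 > m2" and "m2 \<ge> 2"
    and "r = m1 mod m2" and "r \<ge> 1"
    and "real (m1 div m2) > 1 + (real r)\<^sup>2 / (real m2 * (real m2 - real r)) \<or> m1 \<ge> m2\<^sup>2"
  shows "is_boundedness_threshold TYPE('a) TYPE('b) (m1 div m2 + 1) \<and>
         is_existence_threshold TYPE('a) TYPE('b) (m1 div m2 + 1) \<and>
         is_uniqueness_threshold TYPE('a) TYPE('b) (m1 div m2 + 1)"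
proof -
  let ?N = "m1 div m2 + 1"
  note bounds = threshold_sample_size_bounds[OF assms(3-7)]
  have N: "?N \<ge> 1" "?N \<le> CARD('a)" "(CARD('a))\<^sup>2 + (CARD('b))\<^sup>2 < ?N * CARD('a) * CARD('b)"
    "(?N - 1) * CARD('b) < CARD('a)"
    using bounds by (simp_all add: assms(1,2))
  have "is_threshold (mle_exists_uniquely :: nat \<Rightarrow> (nat \<Rightarrow> real^'b^'a) \<Rightarrow> bool) ?N"
    by (rule is_threshold_if_stable[OF stable_sample_mle_exists_uniquely _ N])
       (simp_all add: mle_exists_uniquely_def mle_exists_imp_bounded)
  moreover have "is_threshold (mle_exists :: nat \<Rightarrow> (nat \<Rightarrow> real^'b^'a) \<Rightarrow> bool) ?N"
    by (rule is_threshold_if_stable[OF stable_sample_mle_exists mle_exists_imp_bounded N])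
  moreover have "is_threshold (loglik_bounded :: nat \<Rightarrow> (nat \<Rightarrow> real^'b^'a) \<Rightarrow> bool) ?N"
    by (rule is_threshold_if_stable[OF mle_exists_imp_bounded[OF stable_sample_mle_exists] _ N])
  ultimately show ?thesis
    by (simp only: is_boundedness_threshold_def is_existence_threshold_def is_uniqueness_threshold_def simp_thms)
qed

end
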